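(* Let $b\in\mathbb{N}$, $b\ge2$, and let $W_n$ be the Wiener index of a random linear recursive tree of size $n$ with weight function $u\mapsto1+(b-2)\deg(u)$. Then there exists $D>0$ such that, with $\alpha:=-\log\left(4D(b-1)e\right)$, for every $t>0$, as $n\to\infty$, $$P\left(|W_n-E[W_n]|>tE[W_n]\right)\le\exp\left(-\frac1{b-1}\frac1D\,t\log n\left(\log^{(2)}n+\log t+\alpha+o(1)\right)\right).$$
   Context: Random linear recursive tree: the tree starts with the root and grows node by node; in each step the new node is attached as a child to a randomly chosen existing node, where node $u$ is chosen with probability proportional to its current weight $w_u=1+\beta\deg(u)$. Here $\deg(u)$ is the current number of children of $u$ and $\beta\ge0$ is the parameter of the tree (in this statement $\beta=b-2$). The distance between two nodes is the number of edges on the unique path between them; the Wiener index $W_n$ is the sum of the distances over all unordered pairs of nodes. $\log^{(2)}n=\log\log n$; the $o(1)$ is for $n\to\infty$ with $t$ fixed. *)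

theory Defs
  imports "HOL-Probability.Probability" "HOL-Library.Landau_Symbols"
begin

text \<open>
  A growing rooted tree is recorded by its attachment history, a list of naturals.  The
  nodes are numbered in order of insertion, starting with the root 0, and entry \<open>i\<close> of the
  list is the parent of node \<open>i + 1\<close>.  Hence a list of length \<open>k\<close> describes a tree with
  \<open>k + 1\<close> nodes, and the empty list is the tree consisting of the root alone.
\<close>

type_synonym rtree = "nat list"

definition nodes :: "rtree \<Rightarrow> nat set" where
  "nodes T = {0..length T}"

definition parent_of :: "rtree \<Rightarrow> nat \<Rightarrow> nat \<Rightarrow> bool" where
  "parent_of T u v \<longleftrightarrow> (\<exists>i < length T. v = Suc i \<and> u = T ! i)"

definition children :: "rtree \<Rightarrow> nat \<Rightarrow> nat set" where
  "children T u = {v. parent_of T u v}"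

definition deg :: "rtree \<Rightarrow> nat \<Rightarrow> nat" where
  "deg T u = card (children T u)"

definition weight :: "real \<Rightarrow> rtree \<Rightarrow> nat \<Rightarrow> real" where
  "weight \<beta> T u = 1 + \<beta> * real (deg T u)"

text \<open>
  For \<open>\<beta> \<ge> 0\<close> all weights are positive, so that the argument of \<^const>\<open>embed_pmf\<close> is a
  probability mass function; see \<open>pmf_attach\<close> below.
\<close>

definition attach :: "real \<Rightarrow> rtree \<Rightarrow> nat pmf" where
  "attach \<beta> T = embed_pmf
     (\<lambda>u. if u \<in> nodes T then weight \<beta> T u / (\<Sum>v\<in>nodes T. weight \<beta> T v) else 0)"

lemma weight_ge_1: "\<beta> \<ge> 0 \<Longrightarrow> weight \<beta> T u \<ge> 1"
  by (simp add: weight_def)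

lemma pmf_attach:
  assumes "\<beta> \<ge> 0"
  shows "pmf (attach \<beta> T) u =
    (if u \<in> nodes T then weight \<beta> T u / (\<Sum>v\<in>nodes T. weight \<beta> T v) else 0)"
proof -
  let ?S = "\<Sum>v\<in>nodes T. weight \<beta> T v"
  let ?f = "\<lambda>u. if u \<in> nodes T then weight \<beta> T u / ?S else 0"
  have fin: "finite (nodes T)" and ne: "nodes T \<noteq> {}"
    by (auto simp: nodes_def)
  have pos: "weight \<beta> T v > 0" for v
    using weight_ge_1[OF assms, of T v] by linarith
  have S: "?S > 0"
    using fin ne pos by (intro sum_pos) auto
  have nn: "?f v \<ge> 0" for v
    using S pos[of v] by (auto intro!: divide_nonneg_pos)
  have "(\<integral>\<^sup>+ v. ennreal (?f v) \<partial>count_space UNIV) = (\<Sum>v\<in>nodes T. ennreal (?f v))"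
    by (rule nn_integral_count_space'[OF fin]) auto
  also have "\<dots> = ennreal (\<Sum>v\<in>nodes T. ?f v)"
    by (rule sum_ennreal) (rule nn)
  also have "(\<Sum>v\<in>nodes T. ?f v) = 1"
    using S by (simp flip: sum_divide_distrib)
  finally have "(\<integral>\<^sup>+ v. ennreal (?f v) \<partial>count_space UNIV) = 1"
    by simp
  then show ?thesis
    unfolding attach_def by (intro pmf_embed_pmf nn)
qed

primrec grow :: "real \<Rightarrow> nat \<Rightarrow> rtree pmf" where
  "grow \<beta> 0 = return_pmf []"
| "grow \<beta> (Suc k) = bind_pmf (grow \<beta> k) (\<lambda>T. map_pmf (\<lambda>u. T @ [u]) (attach \<beta> T))"

text \<open>
  A tree with \<open>n\<close> nodes arises from the root by \<open>n - 1\<close> insertions.  There is no tree with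
  0 nodes, and the value at \<open>n = 0\<close> is a dummy.
\<close>

definition linear_recursive_tree :: "real \<Rightarrow> nat \<Rightarrow> rtree pmf" where
  "linear_recursive_tree \<beta> n = grow \<beta> (n - 1)"

definition adjacent :: "rtree \<Rightarrow> nat \<Rightarrow> nat \<Rightarrow> bool" where
  "adjacent T u v \<longleftrightarrow> parent_of T u v \<or> parent_of T v u"

definition is_path :: "rtree \<Rightarrow> nat \<Rightarrow> nat \<Rightarrow> nat list \<Rightarrow> bool" where
  "is_path T u v p \<longleftrightarrow>
     p \<noteq> [] \<and> hd p = u \<and> last p = v \<and> set p \<subseteq> nodes T \<and> distinct p \<and> successively (adjacent T) p"

text \<open>
  A path is given by its list of nodes, so it has one edge less than the list has entries.
  It is unique for every tree in the support of the tree process.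
\<close>

definition tree_dist :: "rtree \<Rightarrow> nat \<Rightarrow> nat \<Rightarrow> nat" where
  "tree_dist T u v = length (THE p. is_path T u v p) - 1"

text \<open>Each unordered pair of distinct nodes is listed once, smaller number first.\<close>

definition wiener_index :: "rtree \<Rightarrow> nat" where
  "wiener_index T = (\<Sum>(u, v)\<in>{(u, v). u \<in> nodes T \<and> v \<in> nodes T \<and> u < v}. tree_dist T u v)"

end

theory Submission
  imports Defs "HOL-Real_Asymp.Real_Asymp"
begin

text \<open>
  The mean of the Wiener index is of order \<open>n\<^sup>2 log n\<close>, so the theorem asks for the probability that the
  centred index divided by \<open>n\<^sup>2\<close> reaches a multiple of \<open>t log n\<close>. Along the growth of the tree
  this quotient is a martingale up to a small drift: a new child of \<open>u\<close> adds the sum of the distances to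
  \<open>u\<close>, plus the number of nodes, and the average of this over the attachment weights is an affine function of the
  Wiener index and the path length (\<open>expectation_attach_wiener_increment\<close>). The increments of the quotient are at
  most of order height divided by size. Hence late insertions hardly matter, while the contribution of the first \<open>m\<close>
  insertions is at most twice the height that the tree has by then (or a multiple of \<open>log m\<close>, if that is larger; see
  \<open>abs_scaled_wiener_le\<close>). A deviation of order \<open>t log n\<close> therefore requires a tree of small size
  \<open>m\<close> whose height is of order \<open>t log n\<close>.

  Depths have Poisson-like exponential moments: the expected sum of \<open>exp (\<mu> * depth)\<close> over the nodes is at most
  \<open>exp ((1 + \<beta>) e\<^sup>\<mu> H)\<close> for a harmonic number \<open>H\<close>
  (\<open>expectation_depth_exp_sum_le\<close>). For \<open>m = (log n)\<^sup>4\<close> the harmonic number is of order \<open>log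
  log n\<close>, so \<open>\<mu> = (log log n) / 2\<close> is affordable, and height of order \<open>t log n\<close> at time
  \<open>m\<close> has probability \<open>exp (- c t log n log log n)\<close>. For the whole tree \<open>\<mu> = 1\<close>
  excludes heights above \<open>h = (log n) powr (3 / 2)\<close> with an even smaller error.

  On trees that satisfy both height constraints, Hoeffding's lemma bounds the moments of \<open>exp (\<theta> * quotient)\<close>;
  the insertions after time \<open>m\<close> contribute only \<open>(\<theta> \<beta> h + \<theta>\<^sup>2 h\<^sup>2) / m\<close>
  to the exponent (\<open>exp_scaled_wiener_tame_le\<close>). This tends to 0 for \<open>\<theta> = log log n\<close>, and with
  this \<open>\<theta>\<close> Markov's inequality yields the same order of decay (\<open>wiener_tail_bound\<close>,
  \<open>wiener_tail_eventually\<close>). As \<open>D\<close> may be large, the constant \<open>c\<close> need not be optimal; it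
  only has to be independent of \<open>t\<close>.
\<close>

section \<open>Paths and distances in growing trees\<close>

text \<open>
  Exactly these histories describe trees: every node is attached to an older one. Outside this set
  \<^const>\<open>tree_dist\<close> may fail to be a distance.
\<close>

definition recursive_tree :: "rtree \<Rightarrow> bool" where
  "recursive_tree T \<longleftrightarrow> (\<forall>i < length T. T ! i \<le> i)"

lemma recursive_tree_Nil [simp]: "recursive_tree []"
  by (simp add: recursive_tree_def)

lemma recursive_tree_snoc [simp]:
  "recursive_tree (T @ [u]) \<longleftrightarrow> recursive_tree T \<and> u \<in> nodes T"
  by (auto simp: recursive_tree_def nodes_def nth_append less_Suc_eq)

lemma finite_nodes [simp]: "finite (nodes T)"
  by (simp add: nodes_def)

lemma root_in_nodes [simp]: "0 \<in> nodes T"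
  by (simp add: nodes_def)

lemma card_nodes [simp]: "card (nodes T) = Suc (length T)"
  by (simp add: nodes_def)

lemma nodes_snoc: "nodes (T @ [u]) = insert (Suc (length T)) (nodes T)"
  by (auto simp: nodes_def)

lemma new_notin_nodes [simp]: "Suc (length T) \<notin> nodes T"
  by (simp add: nodes_def)

lemma nth_in_nodes: "recursive_tree T \<Longrightarrow> i < length T \<Longrightarrow> T ! i \<in> nodes T"
  by (simp add: recursive_tree_def nodes_def) (meson le_trans less_imp_le)

lemma parent_of_snoc:
  "parent_of (T @ [u]) x y \<longleftrightarrow> parent_of T x y \<or> x = u \<and> y = Suc (length T)"
proof -
  have *: "(\<exists>i<Suc n. P i) \<longleftrightarrow> (\<exists>i<n. P i) \<or> P n" for n and P :: "nat \<Rightarrow> bool"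
    by (auto simp: less_Suc_eq)
  have "parent_of (T @ [u]) x y \<longleftrightarrow>
      (\<exists>i<Suc (length T). y = Suc i \<and> x = (T @ [u]) ! i)"
    by (simp add: parent_of_def)
  also have "\<dots> \<longleftrightarrow> (\<exists>i<length T. y = Suc i \<and> x = (T @ [u]) ! i) \<or> x = u \<and> y = Suc (length T)"
    unfolding * by auto
  also have "(\<exists>i<length T. y = Suc i \<and> x = (T @ [u]) ! i) \<longleftrightarrow> parent_of T x y"
    unfolding parent_of_def by (metis nth_append_left)
  finally show ?thesis .
qed

lemma adjacent_snoc:
  "adjacent (T @ [u]) x y \<longleftrightarrow> adjacent T x y \<or> (x = u \<and> y = Suc (length T)) \<or>
     (y = u \<and> x = Suc (length T))"
  by (auto simp: adjacent_def parent_of_snoc)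

lemma adjacent_sym: "adjacent T x y \<longleftrightarrow> adjacent T y x"
  by (auto simp: adjacent_def)

lemma adjacent_in_nodes:
  assumes "recursive_tree T" "adjacent T x y"
  shows "x \<in> nodes T \<and> y \<in> nodes T"
proof -
  have "x \<in> nodes T \<and> y \<in> nodes T" if "parent_of T x y" for x y
    using that nth_in_nodes[OF assms(1)] by (auto simp: parent_of_def nodes_def)
  then show ?thesis
    using assms(2) by (auto simp: adjacent_def)
qed

lemma not_adjacent_new:
  assumes "recursive_tree T"
  shows "\<not> adjacent T x (Suc (length T))" "\<not> adjacent T (Suc (length T)) x"
  using adjacent_in_nodes[OF assms, of x "Suc (length T)"]
    adjacent_in_nodes[OF assms, of "Suc (length T)" x] by auto

lemma is_path_rev: "is_path T u v (rev p) \<longleftrightarrow> is_path T v u p"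
proof -
  have "successively (adjacent T) (rev p) \<longleftrightarrow> successively (adjacent T) p"
    unfolding successively_rev by (intro successively_cong refl) (rule adjacent_sym)
  then show ?thesis
    by (auto simp: is_path_def hd_rev last_rev)
qed

lemma is_path_self: "is_path T u u p \<longleftrightarrow> u \<in> nodes T \<and> p = [u]"
proof
  assume p: "is_path T u u p"
  then obtain xs where xs: "p = u # xs"
    by (cases p) (auto simp: is_path_def)
  with p have "xs = []"
    by (cases xs rule: rev_cases) (auto simp: is_path_def)
  with xs p show "u \<in> nodes T \<and> p = [u]"
    by (auto simp: is_path_def)
qed (auto simp: is_path_def)

text \<open>
  The newest node is a leaf, and a path through it would have to enter and leave by the same neighbour. So attaching a node
  creates no new path between old nodes.
\<close>

lemma is_path_snoc_old:
  assumes "recursive_tree T" "u \<in> nodes T" "v \<in> nodes T" "w \<in> nodes T"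
  shows "is_path (T @ [u]) v w p \<longleftrightarrow> is_path T v w p"
proof
  assume "is_path T v w p"
  then show "is_path (T @ [u]) v w p"
    by (auto simp: is_path_def nodes_snoc adjacent_snoc intro: successively_mono)
next
  let ?N = "Suc (length T)"
  assume p: "is_path (T @ [u]) v w p"
  have "?N \<notin> set p"
  proof
    assume "?N \<in> set p"
    then obtain xs ys where xy: "p = xs @ ?N # ys"
      by (auto simp: in_set_conv_decomp)
    have "xs \<noteq> []" "ys \<noteq> []"
      using p xy assms new_notin_nodes[of T] by (auto simp: is_path_def)
    moreover have "adjacent (T @ [u]) (last xs) ?N" "adjacent (T @ [u]) ?N (hd ys)"
      using p xy calculation by (auto simp: is_path_def successively_append_iff successively_Cons)
    then have "last xs = u" "hd ys = u"
      using not_adjacent_new[OF assms(1)] assms(2) by (auto simp: adjacent_snoc)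
    ultimately have "u \<in> set xs" "u \<in> set ys"
      using last_in_set[of xs] hd_in_set[of ys] by auto
    then show False
      using p xy by (auto simp: is_path_def)
  qed
  then have "successively (adjacent T) p"
    using p unfolding is_path_def
    by (auto simp: adjacent_snoc elim!: successively_mono)
  then show "is_path T v w p"
    using p \<open>?N \<notin> set p\<close> by (auto simp: is_path_def nodes_snoc)
qed

lemma is_path_snoc_new:
  assumes "recursive_tree T" "u \<in> nodes T" "v \<in> nodes T"
  shows "is_path (T @ [u]) v (Suc (length T)) p \<longleftrightarrow> (\<exists>q. p = q @ [Suc (length T)] \<and> is_path T v u q)"
proof
  let ?N = "Suc (length T)"
  assume p: "is_path (T @ [u]) v ?N p"
  then obtain q where q: "p = q @ [?N]"
    by (cases p rule: rev_cases) (auto simp: is_path_def)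
  with p assms new_notin_nodes[of T] have "q \<noteq> []"
    by (auto simp: is_path_def)
  moreover from this have "adjacent (T @ [u]) (last q) ?N"
    using p q by (auto simp: is_path_def successively_append_iff)
  then have "last q = u"
    using not_adjacent_new[OF assms(1)] assms(2) by (auto simp: adjacent_snoc)
  ultimately have "is_path (T @ [u]) v u q"
    using p q by (auto simp: is_path_def successively_append_iff)
  then show "\<exists>q. p = q @ [?N] \<and> is_path T v u q"
    using q is_path_snoc_old[OF assms(1,2,3,2)] by auto
next
  let ?N = "Suc (length T)"
  assume "\<exists>q. p = q @ [?N] \<and> is_path T v u q"
  then obtain q where q: "p = q @ [?N]" "is_path T v u q"
    by auto
  then have "is_path (T @ [u]) v u q"
    using is_path_snoc_old[OF assms(1,2,3,2)] by auto
  moreover have "?N \<notin> set q"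
    using q by (auto simp: is_path_def)
  ultimately show "is_path (T @ [u]) v ?N p"
    using q by (auto simp: is_path_def successively_append_iff nodes_snoc adjacent_snoc)
qed

text \<open>
  Uniqueness is what gives the definite description inside \<^const>\<open>tree_dist\<close> a meaning. The two preceding lemmas
  reduce all paths, up to reversal, to paths in the smaller tree.
\<close>

lemma ex1_path:
  assumes "recursive_tree T" "v \<in> nodes T" "w \<in> nodes T"
  shows "\<exists>!p. is_path T v w p"
  using assms
proof (induction T arbitrary: v w rule: rev_induct)
  case Nil
  then show ?case by (auto simp: nodes_def is_path_self)
next
  case (snoc u T)
  let ?N = "Suc (length T)"
  have T: "recursive_tree T" "u \<in> nodes T"
    using snoc.prems by auto
  have to_new: "\<exists>!p. is_path (T @ [u]) x ?N p" if "x \<in> nodes T" for x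
    using snoc.IH[OF T(1) that T(2)] is_path_snoc_new[OF T that] by metis
  have from_new: "\<exists>!p. is_path (T @ [u]) ?N x p" if x: "x \<in> nodes T" for x
  proof -
    obtain p where p: "is_path (T @ [u]) x ?N p"
        and uniq: "\<And>q. is_path (T @ [u]) x ?N q \<Longrightarrow> q = p"
      using to_new[OF x] by auto
    show ?thesis
    proof (rule ex1I[of _ "rev p"])
      fix q assume "is_path (T @ [u]) ?N x q"
      then have "is_path (T @ [u]) x ?N (rev q)"
        by (simp add: is_path_rev)
      then show "q = rev p"
        using uniq by fastforce
    qed (simp add: is_path_rev p)
  qed
  consider "v \<in> nodes T" "w \<in> nodes T" | "v \<in> nodes T" "w = ?N" | "v = ?N" "w \<in> nodes T" |
    "v = ?N" "w = ?N"
    using snoc.prems by (auto simp: nodes_snoc)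
  then show ?case
  proof cases
    case 1
    then show ?thesis
      using snoc.IH[OF T(1)] is_path_snoc_old[OF T] by auto
  qed (auto simp: to_new from_new is_path_self nodes_snoc)
qed

lemma tree_dist_eq:
  assumes "recursive_tree T" "v \<in> nodes T" "w \<in> nodes T" "is_path T v w p"
  shows "tree_dist T v w = length p - 1"
  using ex1_path[OF assms(1-3)] assms(4) unfolding tree_dist_def by (metis the_equality)

lemma tree_dist_self [simp]: "v \<in> nodes T \<Longrightarrow> tree_dist T v v = 0"
  by (simp add: tree_dist_def is_path_self)

lemma tree_dist_sym:
  assumes "recursive_tree T" "v \<in> nodes T" "w \<in> nodes T"
  shows "tree_dist T v w = tree_dist T w v"
proof -
  obtain p where p: "is_path T v w p"
    using ex1_path[OF assms] by auto
  then have "is_path T w v (rev p)"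
    by (simp add: is_path_rev)
  then show ?thesis
    using p assms by (simp add: tree_dist_eq)
qed

lemma tree_dist_snoc_old:
  assumes "recursive_tree T" "u \<in> nodes T" "v \<in> nodes T" "w \<in> nodes T"
  shows "tree_dist (T @ [u]) v w = tree_dist T v w"
  by (simp add: tree_dist_def is_path_snoc_old[OF assms])

lemma tree_dist_snoc_new:
  assumes "recursive_tree T" "u \<in> nodes T" "v \<in> nodes T"
  shows "tree_dist (T @ [u]) v (Suc (length T)) = Suc (tree_dist T v u)"
proof -
  obtain p where p: "is_path T v u p"
    using ex1_path[OF assms(1,3,2)] by auto
  then have "is_path (T @ [u]) v (Suc (length T)) (p @ [Suc (length T)])"
    by (simp add: is_path_snoc_new[OF assms])
  moreover have "p \<noteq> []"
    using p by (simp add: is_path_def)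
  ultimately show ?thesis
    using p assms by (simp add: tree_dist_eq nodes_snoc)
qed

lemma tree_dist_snoc_new':
  assumes "recursive_tree T" "u \<in> nodes T" "v \<in> nodes T"
  shows "tree_dist (T @ [u]) (Suc (length T)) v = Suc (tree_dist T u v)"
  using assms tree_dist_snoc_new[OF assms] tree_dist_sym[OF assms(1,2,3)]
    tree_dist_sym[of "T @ [u]" "Suc (length T)" v]
  by (simp add: nodes_snoc)

definition dist_sum :: "rtree \<Rightarrow> nat \<Rightarrow> nat" where
  "dist_sum T u = (\<Sum>v\<in>nodes T. tree_dist T v u)"

lemma dist_sum_snoc_old:
  assumes "recursive_tree T" "u \<in> nodes T" "x \<in> nodes T"
  shows "dist_sum (T @ [u]) x = dist_sum T x + tree_dist T u x + 1"
proof -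
  have "dist_sum (T @ [u]) x = Suc (tree_dist T u x) + (\<Sum>v\<in>nodes T. tree_dist (T @ [u]) v x)"
    by (simp add: dist_sum_def nodes_snoc tree_dist_snoc_new'[OF assms])
  also have "(\<Sum>v\<in>nodes T. tree_dist (T @ [u]) v x) = dist_sum T x"
    unfolding dist_sum_def by (intro sum.cong refl tree_dist_snoc_old assms)
  finally show ?thesis by simp
qed

lemma dist_sum_snoc_new:
  assumes "recursive_tree T" "u \<in> nodes T"
  shows "dist_sum (T @ [u]) (Suc (length T)) = dist_sum T u + Suc (length T)"
proof -
  have "dist_sum (T @ [u]) (Suc (length T)) = (\<Sum>v\<in>nodes T. Suc (tree_dist T v u))"
    unfolding dist_sum_def by (simp add: nodes_snoc tree_dist_snoc_new[OF assms])
  then show ?thesis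
    by (simp add: dist_sum_def sum_Suc)
qed

lemma wiener_index_Nil [simp]: "wiener_index [] = 0"
proof -
  have "{(u::nat, v). u \<in> nodes [] \<and> v \<in> nodes [] \<and> u < v} = {}"
    by (auto simp: nodes_def)
  then show ?thesis
    unfolding wiener_index_def by (metis sum.empty)
qed

text \<open>
  The new node is at distance \<open>d(v,u) + 1\<close> from each old node \<open>v\<close>; the old distances do not change.
\<close>

lemma wiener_index_snoc:
  assumes "recursive_tree T" "u \<in> nodes T"
  shows "wiener_index (T @ [u]) = wiener_index T + dist_sum T u + Suc (length T)"
proof -
  let ?N = "Suc (length T)"
  let ?S = "\<lambda>T. {(u, v). u \<in> nodes T \<and> v \<in> nodes T \<and> u < v}"
  have fin: "finite (?S T)"
    by (rule finite_subset[of _ "nodes T \<times> nodes T"]) auto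
  have S: "?S (T @ [u]) = ?S T \<union> (\<lambda>v. (v, ?N)) ` nodes T"
    by (auto simp: nodes_def)
  have "wiener_index (T @ [u]) = (\<Sum>(v, w)\<in>?S T. tree_dist (T @ [u]) v w) +
      (\<Sum>(v, w)\<in>(\<lambda>v. (v, ?N)) ` nodes T. tree_dist (T @ [u]) v w)"
    unfolding wiener_index_def S using fin by (intro sum.union_disjoint) auto
  also have "(\<Sum>(v, w)\<in>?S T. tree_dist (T @ [u]) v w) = wiener_index T"
    unfolding wiener_index_def by (intro sum.cong) (auto simp: tree_dist_snoc_old[OF assms])
  also have "(\<Sum>(v, w)\<in>(\<lambda>v. (v, ?N)) ` nodes T. tree_dist (T @ [u]) v w) =
      (\<Sum>v\<in>nodes T. Suc (tree_dist T v u))"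
    by (subst sum.reindex) (auto simp: inj_on_def tree_dist_snoc_new[OF assms])
  finally show ?thesis
    by (simp add: dist_sum_def sum_Suc)
qed

lemma tree_dist_le_depths:
  assumes "recursive_tree T" "v \<in> nodes T" "w \<in> nodes T"
  shows "tree_dist T v w \<le> tree_dist T 0 v + tree_dist T 0 w"
  using assms
proof (induction T arbitrary: v w rule: rev_induct)
  case Nil
  then show ?case by (simp add: nodes_def)
next
  case (snoc u T)
  have T: "recursive_tree T" "u \<in> nodes T"
    using snoc.prems by auto
  show ?case
    using snoc.prems(2,3) T snoc.IH[OF T(1)]
    by (auto simp: nodes_snoc tree_dist_snoc_old tree_dist_snoc_new tree_dist_snoc_new')
qed

text \<open>
  Replacing a node \<open>v\<close> by its parent changes the distance to \<open>u\<close> by \<open>-1\<close>, except when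
  \<open>v\<close> is \<open>u\<close> or an ancestor of \<open>u\<close> other than the root; then it changes by
  \<open>+1\<close>. There are \<open>d(0,u)\<close> such exceptions, each of which adds 2 instead of 0 to the sum of
  \<open>d(parent v, u) - d(v,u) + 1\<close>.
\<close>

lemma sum_parent_dist:
  assumes "recursive_tree T" "u \<in> nodes T"
  shows "(\<Sum>i<length T. tree_dist T (T ! i) u + 1) = dist_sum T u + tree_dist T 0 u"
  using assms
proof (induction T arbitrary: u rule: rev_induct)
  case Nil
  then show ?case by (simp add: nodes_def dist_sum_def)
next
  case (snoc x T)
  have T: "recursive_tree T" "x \<in> nodes T"
    using snoc.prems by auto
  have nth: "(T @ [x]) ! i = T ! i" if "i < length T" for i
    using that by (simp add: nth_append)
  show ?case
  proof (cases "u \<in> nodes T")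
    case True
    then have "(\<Sum>i<length T. tree_dist (T @ [x]) ((T @ [x]) ! i) u + 1) =
        (\<Sum>i<length T. tree_dist T (T ! i) u + 1)"
      by (intro sum.cong) (auto simp: nth tree_dist_snoc_old T nth_in_nodes)
    then show ?thesis
      using True T snoc.IH[OF T(1) True] by (simp add: tree_dist_snoc_old dist_sum_snoc_old)
  next
    case False
    then have u: "u = Suc (length T)"
      using snoc.prems by (simp add: nodes_snoc)
    have "(\<Sum>i<length T. tree_dist (T @ [x]) ((T @ [x]) ! i) u + 1) =
        (\<Sum>i<length T. (tree_dist T (T ! i) x + 1) + 1)"
      by (intro sum.cong) (auto simp: nth u tree_dist_snoc_new T nth_in_nodes)
    also have "\<dots> = dist_sum T x + tree_dist T 0 x + length T"
      using snoc.IH[OF T] by (simp only: sum.distrib) simp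
    finally show ?thesis
      using T by (simp add: u tree_dist_snoc_new dist_sum_snoc_new)
  qed
qed

text \<open>
  The previous lemma, summed over \<open>u\<close>. A node with \<open>d\<close> children occurs \<open>d\<close> times as a
  parent, so the left-hand side collects the part of the attachment weights that depends on the degrees. This is why the expected
  growth of the Wiener index involves only the index itself and the path length \<^term>\<open>dist_sum T 0\<close>.
\<close>

lemma sum_parent_dist_sum:
  assumes "recursive_tree T"
  shows "(\<Sum>i<length T. dist_sum T (T ! i)) + length T * Suc (length T) =
    2 * wiener_index T + dist_sum T 0"
  using assms
proof (induction T rule: rev_induct)
  case Nil
  then show ?case by (simp add: nodes_def dist_sum_def)
next
  case (snoc x T)
  have T: "recursive_tree T" "x \<in> nodes T"
    using snoc.prems by auto
  have "(\<Sum>i<length T. dist_sum (T @ [x]) ((T @ [x]) ! i)) =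
      (\<Sum>i<length T. dist_sum T (T ! i) + (tree_dist T (T ! i) x + 1))"
    by (intro sum.cong)
      (auto simp: nth_append dist_sum_snoc_old T nth_in_nodes tree_dist_sym)
  also have "\<dots> = (\<Sum>i<length T. dist_sum T (T ! i)) + (dist_sum T x + tree_dist T 0 x)"
    using sum_parent_dist[OF T] by (simp only: sum.distrib)
  finally show ?case
    using snoc.IH[OF T(1)] T tree_dist_sym[OF T(1), of 0 x]
    by (simp add: dist_sum_snoc_old wiener_index_snoc)
qed

lemma sum_dist_sum:
  assumes "recursive_tree T"
  shows "(\<Sum>u\<in>nodes T. dist_sum T u) = 2 * wiener_index T"
  using assms
proof (induction T rule: rev_induct)
  case Nil
  then show ?case by (simp add: nodes_def dist_sum_def)
next
  case (snoc x T)
  have T: "recursive_tree T" "x \<in> nodes T"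
    using snoc.prems by auto
  have "(\<Sum>u\<in>nodes T. dist_sum (T @ [x]) u) = (\<Sum>u\<in>nodes T. dist_sum T u + Suc (tree_dist T u x))"
    by (intro sum.cong) (auto simp: dist_sum_snoc_old T tree_dist_sym)
  also have "\<dots> = 2 * wiener_index T + dist_sum T x + Suc (length T)"
    using snoc.IH[OF T(1)] by (simp add: sum.distrib dist_sum_def sum_Suc)
  finally show ?case
    using T by (simp add: nodes_snoc dist_sum_snoc_new wiener_index_snoc)
qed

section \<open>Attachment probabilities and mean values\<close>

lemma sum_deg:
  assumes "recursive_tree T"
  shows "(\<Sum>u\<in>nodes T. real (deg T u) * f u) = (\<Sum>i<length T. f (T ! i))"
proof -
  have ch: "children T u = Suc ` {i\<in>{..<length T}. T ! i = u}" for u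
    by (auto simp: children_def parent_of_def)
  have "real (deg T u) * f u = (\<Sum>i\<in>{i\<in>{..<length T}. T ! i = u}. f (T ! i))" for u
    unfolding deg_def ch by (simp add: card_image)
  then have "(\<Sum>u\<in>nodes T. real (deg T u) * f u) =
      (\<Sum>u\<in>nodes T. \<Sum>i\<in>{i\<in>{..<length T}. T ! i = u}. f (T ! i))"
    by (rule sum.cong[OF refl])
  also have "\<dots> = (\<Sum>i<length T. f (T ! i))"
    by (rule sum.group) (auto simp: nth_in_nodes assms)
  finally show ?thesis .
qed

lemma sum_weight_mult:
  assumes "recursive_tree T"
  shows "(\<Sum>u\<in>nodes T. weight \<beta> T u * f u) = (\<Sum>u\<in>nodes T. f u) + \<beta> * (\<Sum>i<length T. f (T ! i))"
proof -
  have "(\<Sum>u\<in>nodes T. weight \<beta> T u * f u) =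
      (\<Sum>u\<in>nodes T. f u + \<beta> * (real (deg T u) * f u))"
    by (simp add: weight_def algebra_simps)
  also have "\<dots> = (\<Sum>u\<in>nodes T. f u) + \<beta> * (\<Sum>u\<in>nodes T. real (deg T u) * f u)"
    by (simp only: sum.distrib sum_distrib_left)
  finally show ?thesis
    by (simp only: sum_deg[OF assms])
qed

lemma sum_weight:
  assumes "recursive_tree T"
  shows "(\<Sum>u\<in>nodes T. weight \<beta> T u) = 1 + (1 + \<beta>) * length T"
  using sum_weight_mult[OF assms, of \<beta> "\<lambda>_. 1"] by (simp add: algebra_simps)

text \<open>
  The parameter \<open>k\<close> counts insertions, so the tree has \<open>k + 1\<close> nodes.
\<close>

definition total_weight :: "real \<Rightarrow> nat \<Rightarrow> real" where
  "total_weight \<beta> k = 1 + (1 + \<beta>) * real k"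

definition mean_wiener :: "real \<Rightarrow> nat \<Rightarrow> real" where
  "mean_wiener \<beta> k = measure_pmf.expectation (grow \<beta> k) (\<lambda>T. real (wiener_index T))"

definition mean_path_length :: "real \<Rightarrow> nat \<Rightarrow> real" where
  "mean_path_length \<beta> k = measure_pmf.expectation (grow \<beta> k) (\<lambda>T. real (dist_sum T 0))"

text \<open>
  This shift makes the total weight proportional to \<open>k + root_offset \<beta>\<close>, so that products of the growth factors
  telescope without error.
\<close>

definition root_offset :: "real \<Rightarrow> real" where
  "root_offset \<beta> = 1 / (1 + \<beta>)"

context
  fixes \<beta> :: real
  assumes beta: "\<beta> \<ge> 0"
begin

lemma set_pmf_attach: "set_pmf (attach \<beta> T) = nodes T"
proof -
  have w: "weight \<beta> T u > 0" for u
    using weight_ge_1[OF beta, of T u] by linarith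
  then have "(\<Sum>v\<in>nodes T. weight \<beta> T v) > 0"
    by (intro sum_pos) (auto simp: nodes_def)
  then show ?thesis
    using w by (auto simp: set_pmf_eq pmf_attach[OF beta] less_imp_neq[symmetric])
qed

lemma set_pmf_grow: "T \<in> set_pmf (grow \<beta> k) \<Longrightarrow> recursive_tree T \<and> length T = k"
  by (induction k arbitrary: T) (auto simp: set_pmf_attach)

lemma finite_set_pmf_grow: "finite (set_pmf (grow \<beta> k))"
  by (induction k) (auto simp: set_pmf_attach)

lemma integrable_grow: "integrable (measure_pmf (grow \<beta> k)) (f :: rtree \<Rightarrow> real)"
  by (intro integrable_measure_pmf_finite finite_set_pmf_grow)

lemma integrable_attach: "integrable (measure_pmf (attach \<beta> T)) (f :: nat \<Rightarrow> real)"
  by (intro integrable_measure_pmf_finite) (simp add: set_pmf_attach)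

lemma expectation_grow_mono:
  fixes f g :: "rtree \<Rightarrow> real"
  assumes "\<And>T. recursive_tree T \<Longrightarrow> length T = k \<Longrightarrow> f T \<le> g T"
  shows "measure_pmf.expectation (grow \<beta> k) f \<le> measure_pmf.expectation (grow \<beta> k) g"
  by (intro integral_mono_AE integrable_grow) (auto simp: AE_measure_pmf_iff intro: assms dest: set_pmf_grow)

lemma expectation_grow_cong:
  fixes f g :: "rtree \<Rightarrow> real"
  assumes "\<And>T. recursive_tree T \<Longrightarrow> length T = k \<Longrightarrow> f T = g T"
  shows "measure_pmf.expectation (grow \<beta> k) f = measure_pmf.expectation (grow \<beta> k) g"
  by (intro antisym expectation_grow_mono) (simp_all add: assms)

lemma expectation_grow_Suc:
  fixes f :: "rtree \<Rightarrow> real"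
  shows "measure_pmf.expectation (grow \<beta> (Suc k)) f =
    measure_pmf.expectation (grow \<beta> k) (\<lambda>T. measure_pmf.expectation (attach \<beta> T) (\<lambda>u. f (T @ [u])))"
proof -
  have "measure_pmf.expectation (grow \<beta> (Suc k)) f = (\<Sum>T\<in>set_pmf (grow \<beta> k).
      pmf (grow \<beta> k) T *\<^sub>R measure_pmf.expectation (map_pmf (\<lambda>u. T @ [u]) (attach \<beta> T)) f)"
    unfolding grow.simps
    by (intro pmf_expectation_bind finite_set_pmf_grow) (auto simp: set_pmf_attach)
  also have "\<dots> = measure_pmf.expectation (grow \<beta> k)
      (\<lambda>T. measure_pmf.expectation (attach \<beta> T) (\<lambda>u. f (T @ [u])))"
    by (subst integral_measure_pmf[OF finite_set_pmf_grow]) auto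
  finally show ?thesis .
qed

lemma expectation_attach:
  fixes f :: "nat \<Rightarrow> real"
  assumes "recursive_tree T"
  shows "measure_pmf.expectation (attach \<beta> T) f =
    ((\<Sum>u\<in>nodes T. f u) + \<beta> * (\<Sum>i<length T. f (T ! i))) / (1 + (1 + \<beta>) * length T)"
proof -
  have "measure_pmf.expectation (attach \<beta> T) f =
      (\<Sum>u\<in>nodes T. weight \<beta> T u / (\<Sum>v\<in>nodes T. weight \<beta> T v) * f u)"
    by (subst integral_measure_pmf[of "nodes T"]) (auto simp: set_pmf_attach pmf_attach[OF beta])
  also have "\<dots> = (\<Sum>u\<in>nodes T. weight \<beta> T u * f u) / (\<Sum>v\<in>nodes T. weight \<beta> T v)"
    by (simp add: sum_divide_distrib)
  finally show ?thesis
    by (simp only: sum_weight[OF assms] sum_weight_mult[OF assms])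
qed

lemma total_weight_ge: "total_weight \<beta> k \<ge> real k + 1"
  using beta by (simp add: total_weight_def algebra_simps)

lemma total_weight_le: "total_weight \<beta> k \<le> (1 + \<beta>) * (real k + 1)"
  using beta by (simp add: total_weight_def algebra_simps)

lemma total_weight_pos: "total_weight \<beta> k > 0"
  using total_weight_ge[of k] by linarith

lemma expectation_attach_dist_sum:
  assumes "recursive_tree T"
  shows "measure_pmf.expectation (attach \<beta> T) (\<lambda>u. real (dist_sum T u)) =
    (2 * real (wiener_index T) + \<beta> * (2 * real (wiener_index T) + real (dist_sum T 0)
       - real (length T) * (real (length T) + 1))) / total_weight \<beta> (length T)"
proof -
  have "(\<Sum>u\<in>nodes T. real (dist_sum T u)) = 2 * real (wiener_index T)"
    using sum_dist_sum[OF assms] by (metis of_nat_mult of_nat_numeral of_nat_sum)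
  moreover have "real ((\<Sum>i<length T. dist_sum T (T ! i)) + length T * Suc (length T)) =
      real (2 * wiener_index T + dist_sum T 0)"
    by (simp only: sum_parent_dist_sum[OF assms])
  then have "(\<Sum>i<length T. real (dist_sum T (T ! i))) =
      2 * real (wiener_index T) + real (dist_sum T 0) - real (length T) * (real (length T) + 1)"
    by (simp add: algebra_simps)
  ultimately show ?thesis
    by (simp add: expectation_attach[OF assms] total_weight_def)
qed

text \<open>
  The average is taken with the weights \<open>1 + \<beta> deg u\<close>; the two parts are evaluated by
  \<open>sum_dist_sum\<close> and \<open>sum_parent_dist_sum\<close>. The only random term besides the Wiener index is the path
  length, which is of smaller order.
\<close>

lemma expectation_attach_wiener_increment:
  assumes "recursive_tree T"
  shows "measure_pmf.expectation (attach \<beta> T) (\<lambda>u. real (dist_sum T u)) + (real (length T) + 1) =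
    real (wiener_index T) * (2 * (1 + \<beta>) / total_weight \<beta> (length T)) +
    \<beta> / total_weight \<beta> (length T) * real (dist_sum T 0) +
    (real (length T) + 1)\<^sup>2 / total_weight \<beta> (length T)"
proof -
  let ?k = "length T" and ?s = "total_weight \<beta> (length T)"
  have "measure_pmf.expectation (attach \<beta> T) (\<lambda>u. real (dist_sum T u)) + (real ?k + 1) =
      real (wiener_index T) * (2 * (1 + \<beta>) / ?s) + \<beta> / ?s * real (dist_sum T 0) +
      (?s - \<beta> * real ?k) * (real ?k + 1) / ?s"
    using total_weight_pos[of ?k]
    by (simp add: expectation_attach_dist_sum[OF assms] field_simps)
  also have "?s - \<beta> * real ?k = real ?k + 1"
    by (simp add: total_weight_def algebra_simps)
  finally show ?thesis
    by (simp add: power2_eq_square)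
qed

lemma expectation_attach_wiener:
  assumes "recursive_tree T"
  shows "measure_pmf.expectation (attach \<beta> T) (\<lambda>u. real (wiener_index (T @ [u]))) =
    real (wiener_index T) * (1 + 2 * (1 + \<beta>) / total_weight \<beta> (length T)) +
    \<beta> / total_weight \<beta> (length T) * real (dist_sum T 0) +
    (real (length T) + 1)\<^sup>2 / total_weight \<beta> (length T)"
proof -
  have "measure_pmf.expectation (attach \<beta> T) (\<lambda>u. real (wiener_index (T @ [u]))) =
      measure_pmf.expectation (attach \<beta> T)
        (\<lambda>u. real (dist_sum T u) + (real (wiener_index T) + (real (length T) + 1)))"
    by (intro integral_cong_AE)
      (auto simp: AE_measure_pmf_iff set_pmf_attach wiener_index_snoc assms)
  also have "\<dots> = measure_pmf.expectation (attach \<beta> T) (\<lambda>u. real (dist_sum T u)) +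
      (real (wiener_index T) + (real (length T) + 1))"
    by (subst Bochner_Integration.integral_add) (auto intro: integrable_attach)
  finally show ?thesis
    using expectation_attach_wiener_increment[OF assms] by (simp only: distrib_left)
qed

lemma mean_wiener_Suc:
  "mean_wiener \<beta> (Suc k) = mean_wiener \<beta> k * (1 + 2 * (1 + \<beta>) / total_weight \<beta> k) +
     \<beta> / total_weight \<beta> k * mean_path_length \<beta> k + (real k + 1)\<^sup>2 / total_weight \<beta> k"
proof -
  have "mean_wiener \<beta> (Suc k) = measure_pmf.expectation (grow \<beta> k) (\<lambda>T.
      real (wiener_index T) * (1 + 2 * (1 + \<beta>) / total_weight \<beta> k) +
      \<beta> / total_weight \<beta> k * real (dist_sum T 0) + (real k + 1)\<^sup>2 / total_weight \<beta> k)"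
    unfolding mean_wiener_def expectation_grow_Suc
    by (intro expectation_grow_cong) (simp add: expectation_attach_wiener)
  also have "\<dots> = mean_wiener \<beta> k * (1 + 2 * (1 + \<beta>) / total_weight \<beta> k) +
     \<beta> / total_weight \<beta> k * mean_path_length \<beta> k + (real k + 1)\<^sup>2 / total_weight \<beta> k"
    by (simp add: integrable_grow mean_wiener_def mean_path_length_def)
  finally show ?thesis .
qed

lemma expectation_attach_path_length:
  assumes "recursive_tree T"
  shows "measure_pmf.expectation (attach \<beta> T) (\<lambda>u. real (dist_sum (T @ [u]) 0)) \<le>
    real (dist_sum T 0) * (1 + (1 + \<beta>) / total_weight \<beta> (length T)) + 1"
proof -
  let ?k = "length T" and ?s = "total_weight \<beta> (length T)"
  have "real (\<Sum>i<?k. tree_dist T (T ! i) 0 + 1) = real (dist_sum T 0)"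
    by (subst sum_parent_dist) (simp_all add: assms)
  then have parents: "(\<Sum>i<?k. real (tree_dist T (T ! i) 0)) = real (dist_sum T 0) - ?k"
    by (simp add: sum.distrib)
  have nodes: "(\<Sum>u\<in>nodes T. real (tree_dist T u 0)) = real (dist_sum T 0)"
    by (simp add: dist_sum_def)
  have "measure_pmf.expectation (attach \<beta> T) (\<lambda>u. real (tree_dist T u 0)) =
      ((1 + \<beta>) * real (dist_sum T 0) - \<beta> * ?k) / ?s"
    unfolding expectation_attach[OF assms] total_weight_def parents nodes
    by (simp add: algebra_simps)
  also have "\<dots> \<le> (1 + \<beta>) * real (dist_sum T 0) / ?s"
    using beta total_weight_pos[of ?k] by (intro divide_right_mono) auto
  finally have "measure_pmf.expectation (attach \<beta> T) (\<lambda>u. real (tree_dist T u 0)) \<le>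
      (1 + \<beta>) * real (dist_sum T 0) / ?s" .
  moreover have "measure_pmf.expectation (attach \<beta> T) (\<lambda>u. real (dist_sum (T @ [u]) 0)) =
      measure_pmf.expectation (attach \<beta> T) (\<lambda>u. real (tree_dist T u 0) + (real (dist_sum T 0) + 1))"
    by (intro integral_cong_AE)
      (auto simp: AE_measure_pmf_iff set_pmf_attach dist_sum_snoc_old assms)
  moreover have "\<dots> = measure_pmf.expectation (attach \<beta> T) (\<lambda>u. real (tree_dist T u 0)) +
      (real (dist_sum T 0) + 1)"
    by (subst Bochner_Integration.integral_add) (auto intro: integrable_attach)
  ultimately show ?thesis
    by (simp add: algebra_simps)
qed

lemma mean_path_length_nonneg: "mean_path_length \<beta> k \<ge> 0"
  unfolding mean_path_length_def by simp

lemma mean_wiener_nonneg: "mean_wiener \<beta> k \<ge> 0"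
  unfolding mean_wiener_def by simp

lemma root_offset: "root_offset \<beta> > 0" "root_offset \<beta> \<le> 1"
  using beta by (auto simp: root_offset_def)

lemma total_weight_ratio: "(1 + \<beta>) / total_weight \<beta> k = 1 / (real k + root_offset \<beta>)"
  using beta by (simp add: total_weight_def root_offset_def field_simps)

text \<open>
  Divided by \<open>k + root_offset \<beta>\<close>, the mean path length grows by at most the reciprocal of the tree size in each
  step.
\<close>

lemma mean_path_length_le: "mean_path_length \<beta> k \<le> (real k + root_offset \<beta>) * harm k"
proof (induction k)
  case 0
  then show ?case
    by (simp add: mean_path_length_def dist_sum_def nodes_def harm_def)
next
  case (Suc k)
  let ?a = "real k + root_offset \<beta>"
  have a: "?a > 0"
    using root_offset by simp
  have "mean_path_length \<beta> (Suc k) \<le> measure_pmf.expectation (grow \<beta> k) (\<lambda>T.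
      real (dist_sum T 0) * (1 + (1 + \<beta>) / total_weight \<beta> k) + 1)"
    unfolding mean_path_length_def expectation_grow_Suc
    by (intro expectation_grow_mono) (metis expectation_attach_path_length)
  also have "\<dots> = mean_path_length \<beta> k * (1 + 1 / ?a) + 1"
    by (simp add: integrable_grow mean_path_length_def total_weight_ratio)
  also have "\<dots> \<le> ?a * harm k * (1 + 1 / ?a) + 1"
    using Suc.IH a by (intro add_right_mono mult_right_mono) auto
  also have "\<dots> = (?a + 1) * harm k + 1"
    using a by (simp add: field_simps)
  also have "\<dots> \<le> (?a + 1) * harm k + (?a + 1) / (real k + 1)"
    using root_offset by simp
  also have "\<dots> = (real (Suc k) + root_offset \<beta>) * harm (Suc k)"
    by (simp add: harm_Suc field_simps)
  finally show ?case .
qed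

text \<open>
  The order \<open>n\<^sup>2 log n\<close> of the mean: after division by \<open>(k + 1) (k + 2)\<close> the recursion adds at
  least \<open>1 / (3 (1 + \<beta>) (k + 2))\<close> in each step, which is a constant multiple of the increment of the harmonic
  number.
\<close>

lemma mean_wiener_ge:
  "mean_wiener \<beta> k \<ge> (real k + 1) * (real k + 2) * ((harm (Suc k) - 1) / (3 * (1 + \<beta>)))"
proof (induction k)
  case 0
  then show ?case by (simp add: mean_wiener_nonneg harm_def)
next
  case (Suc k)
  let ?c = "(harm (Suc k) - 1) / (3 * (1 + \<beta>))" and ?x = "real k" and ?s = "total_weight \<beta> k"
  have pos: "?s > 0" "1 + \<beta> > 0"
    using total_weight_pos beta by auto
  have "2 / (?x + 1) = (1 + \<beta>) * 2 / ((1 + \<beta>) * (?x + 1))"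
    using pos by (intro nonzero_mult_divide_mult_cancel_left[symmetric]) simp
  also have "\<dots> \<le> (1 + \<beta>) * 2 / ?s"
    using total_weight_le[of k] pos by (intro divide_left_mono) auto
  also have "\<dots> = 2 * (1 + \<beta>) / ?s"
    by simp
  finally have s: "2 / (?x + 1) \<le> 2 * (1 + \<beta>) / ?s" .
  have q: "(?x + 1) * (1 + 2 / (?x + 1)) = ?x + 3"
    by (simp add: field_simps)
  have "(?x + 2) * (?x + 3) * ?c = ((?x + 1) * (1 + 2 / (?x + 1))) * (?x + 2) * ?c"
    by (simp only: q mult_ac)
  also have "\<dots> = (?x + 1) * (?x + 2) * ?c * (1 + 2 / (?x + 1))"
    by (simp only: mult_ac)
  also have "\<dots> \<le> mean_wiener \<beta> k * (1 + 2 / (?x + 1))"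
    using Suc.IH by (intro mult_right_mono) auto
  also have "\<dots> \<le> mean_wiener \<beta> k * (1 + 2 * (1 + \<beta>) / ?s)"
    using s by (intro mult_left_mono add_left_mono mean_wiener_nonneg)
  finally have 1: "(?x + 2) * (?x + 3) * ?c \<le> mean_wiener \<beta> k * (1 + 2 * (1 + \<beta>) / ?s)" .
  have "(?x + 3) / (3 * (1 + \<beta>)) \<le> (?x + 1) / (1 + \<beta>)"
  proof -
    have "(?x + 3) / 3 / (1 + \<beta>) \<le> (?x + 1) / (1 + \<beta>)"
      using pos by (intro divide_right_mono) auto
    then show ?thesis
      by simp
  qed
  also have "\<dots> = (?x + 1)\<^sup>2 / ((1 + \<beta>) * (?x + 1))"
    by (simp add: power2_eq_square)
  also have "\<dots> \<le> (?x + 1)\<^sup>2 / ?s"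
    using total_weight_le[of k] pos by (intro divide_left_mono) auto
  finally have 2: "(?x + 3) / (3 * (1 + \<beta>)) \<le> (?x + 1)\<^sup>2 / ?s" .
  have "(real (Suc k) + 1) * (real (Suc k) + 2) * ((harm (Suc (Suc k)) - 1) / (3 * (1 + \<beta>))) =
      (?x + 2) * (?x + 3) * (?c + 1 / (?x + 2) / (3 * (1 + \<beta>)))"
  proof -
    have "harm (Suc (Suc k)) - 1 = (harm (Suc k) - 1) + 1 / (?x + 2)"
      by (simp add: harm_Suc[of "Suc k"] divide_inverse)
    moreover have "real (Suc k) + 1 = ?x + 2" "real (Suc k) + 2 = ?x + 3"
      by simp_all
    ultimately show ?thesis
      by (simp only: add_divide_distrib)
  qed
  also have "\<dots> = (?x + 2) * (?x + 3) * ?c + (?x + 3) / (3 * (1 + \<beta>))"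
  proof -
    have cancel: "y * z * (1 / y / C) = z / C" if "y > 0" for y z C :: real
      using that by simp
    have "?x + 2 > 0"
      by simp
    then show ?thesis
      by (simp only: distrib_left[of "(?x + 2) * (?x + 3)" ?c] cancel)
  qed
  also have "\<dots> \<le> mean_wiener \<beta> (Suc k)"
  proof -
    have "0 \<le> \<beta> / ?s * mean_path_length \<beta> k"
      using beta pos mean_path_length_nonneg[of k] by simp
    with 1 2 show ?thesis
      unfolding mean_wiener_Suc by linarith
  qed
  finally show ?case .
qed

end

section \<open>Depths\<close>

definition depth_le :: "real \<Rightarrow> rtree \<Rightarrow> bool" where
  "depth_le h T \<longleftrightarrow> (\<forall>v\<in>nodes T. real (tree_dist T 0 v) \<le> h)"

lemma depth_le_snoc:
  assumes "recursive_tree T" "u \<in> nodes T" "depth_le h (T @ [u])"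
  shows "depth_le h T"
  using assms by (auto simp: depth_le_def nodes_snoc tree_dist_snoc_old)

lemma dist_sum_le:
  assumes "recursive_tree T" "depth_le h T" "u \<in> nodes T"
  shows "real (dist_sum T u) \<le> (real (length T) + 1) * (2 * h)"
proof -
  have "real (dist_sum T u) = (\<Sum>v\<in>nodes T. real (tree_dist T v u))"
    by (simp add: dist_sum_def)
  also have "\<dots> \<le> (\<Sum>v\<in>nodes T. 2 * h)"
  proof (rule sum_mono)
    fix v assume v: "v \<in> nodes T"
    have "real (tree_dist T v u) \<le> real (tree_dist T 0 v) + real (tree_dist T 0 u)"
      using tree_dist_le_depths[OF assms(1) v assms(3)] by linarith
    moreover have "real (tree_dist T 0 v) \<le> h" "real (tree_dist T 0 u) \<le> h"
      using assms(2,3) v by (auto simp: depth_le_def)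
    ultimately show "real (tree_dist T v u) \<le> 2 * h"
      by linarith
  qed
  finally show ?thesis by (simp add: algebra_simps)
qed

lemma path_length_le:
  assumes "recursive_tree T" "depth_le h T"
  shows "real (dist_sum T 0) \<le> (real (length T) + 1) * h"
proof -
  have "real (dist_sum T 0) = (\<Sum>v\<in>nodes T. real (tree_dist T 0 v))"
    by (simp add: dist_sum_def tree_dist_sym[OF assms(1)])
  also have "\<dots> \<le> (\<Sum>v\<in>nodes T. h)"
    using assms(2) by (intro sum_mono) (simp add: depth_le_def)
  finally show ?thesis by (simp add: algebra_simps)
qed

lemma wiener_index_le_path_length:
  assumes "recursive_tree T"
  shows "wiener_index T \<le> Suc (length T) * dist_sum T 0"
proof -
  have root: "(\<Sum>v\<in>nodes T. tree_dist T 0 v) = dist_sum T 0"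
    by (simp add: dist_sum_def tree_dist_sym[OF assms])
  have "2 * wiener_index T = (\<Sum>u\<in>nodes T. \<Sum>v\<in>nodes T. tree_dist T v u)"
    by (simp add: sum_dist_sum[OF assms, symmetric] dist_sum_def)
  also have "\<dots> \<le> (\<Sum>u\<in>nodes T. \<Sum>v\<in>nodes T. tree_dist T 0 v + tree_dist T 0 u)"
    by (intro sum_mono tree_dist_le_depths assms)
  also have "\<dots> = 2 * (Suc (length T) * dist_sum T 0)"
    by (simp add: sum.distrib root flip: sum_distrib_left)
  finally show ?thesis by simp
qed

text \<open>
  The left-hand side runs over the nodes other than the root, each with the depth of its parent, which is smaller by one than its
  own. This controls the preference for nodes of high degree in the growth of \<open>depth_exp_sum\<close> below.
\<close>

lemma sum_parent_depth_le:
  assumes "recursive_tree T" "mono (f :: nat \<Rightarrow> real)" "f 0 \<ge> 0"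
  shows "(\<Sum>i<length T. f (tree_dist T 0 (T ! i))) \<le> (\<Sum>v\<in>nodes T. f (tree_dist T 0 v))"
  using assms(1)
proof (induction T rule: rev_induct)
  case Nil
  then show ?case by (simp add: nodes_def assms)
next
  case (snoc x T)
  have T: "recursive_tree T" "x \<in> nodes T"
    using snoc.prems by auto
  have "(\<Sum>i<length T. f (tree_dist (T @ [x]) 0 ((T @ [x]) ! i))) =
      (\<Sum>i<length T. f (tree_dist T 0 (T ! i)))"
    by (intro sum.cong) (auto simp: nth_append tree_dist_snoc_old T nth_in_nodes)
  moreover have "(\<Sum>v\<in>nodes T. f (tree_dist (T @ [x]) 0 v)) = (\<Sum>v\<in>nodes T. f (tree_dist T 0 v))"
    by (intro sum.cong) (auto simp: tree_dist_snoc_old T)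
  moreover have "f (tree_dist T 0 x) \<le> f (Suc (tree_dist T 0 x))"
    by (rule monoD[OF assms(2)]) simp
  ultimately show ?case
    using snoc.IH[OF T(1)] T by (simp add: nodes_snoc tree_dist_snoc_old tree_dist_snoc_new)
qed

definition depth_exp_sum :: "real \<Rightarrow> rtree \<Rightarrow> real" where
  "depth_exp_sum \<mu> T = (\<Sum>v\<in>nodes T. exp (\<mu> * tree_dist T 0 v))"

lemma depth_exp_sum_nonneg: "depth_exp_sum \<mu> T \<ge> 0"
  unfolding depth_exp_sum_def by (intro sum_nonneg) simp

lemma depth_exp_sum_ge:
  assumes "\<mu> \<ge> 0" "\<not> depth_le h T"
  shows "exp (\<mu> * h) \<le> depth_exp_sum \<mu> T"
proof -
  obtain v where v: "v \<in> nodes T" "real (tree_dist T 0 v) > h"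
    using assms(2) by (auto simp: depth_le_def)
  have "exp (\<mu> * h) \<le> exp (\<mu> * tree_dist T 0 v)"
    using v assms(1) by (auto intro: mult_left_mono)
  also have "\<dots> \<le> depth_exp_sum \<mu> T"
    unfolding depth_exp_sum_def using v(1)
    by (intro member_le_sum) auto
  finally show ?thesis .
qed

context
  fixes \<beta> :: real
  assumes beta: "\<beta> \<ge> 0"
begin

text \<open>
  A new node contributes \<open>e\<^sup>\<mu>\<close> times the weighted average of the old contributions, so the expectation
  grows at most by the factor \<open>1 + (1 + \<beta>) e\<^sup>\<mu> / n\<close>. The dependence on \<open>e\<^sup>\<mu>\<close>
  is that of a Poisson distribution with mean of order \<open>log n\<close>; it is the source of the factor \<open>log log
  n\<close> in the exponent of the theorem.
\<close>

lemma expectation_depth_exp_sum_le: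
  assumes "\<mu> \<ge> 0"
  shows "measure_pmf.expectation (grow \<beta> k) (depth_exp_sum \<mu>) \<le> exp ((1 + \<beta>) * exp \<mu> * harm k)"
proof (induction k)
  case 0
  then show ?case by (simp add: depth_exp_sum_def nodes_def harm_def)
next
  case (Suc k)
  let ?B = "(1 + \<beta>) * exp \<mu>"
  have step: "measure_pmf.expectation (attach \<beta> T) (\<lambda>u. depth_exp_sum \<mu> (T @ [u])) \<le>
      (1 + ?B / (real k + 1)) * depth_exp_sum \<mu> T"
    if T: "recursive_tree T" "length T = k" for T
  proof -
    let ?f = "\<lambda>d::nat. exp (\<mu> * real d)"
    have "measure_pmf.expectation (attach \<beta> T) (\<lambda>u. depth_exp_sum \<mu> (T @ [u])) =
        measure_pmf.expectation (attach \<beta> T)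
          (\<lambda>u. depth_exp_sum \<mu> T + exp \<mu> * ?f (tree_dist T 0 u))"
    proof (intro integral_cong_AE)
      show "AE u in attach \<beta> T. depth_exp_sum \<mu> (T @ [u]) =
          depth_exp_sum \<mu> T + exp \<mu> * ?f (tree_dist T 0 u)"
      proof (simp add: AE_measure_pmf_iff set_pmf_attach[OF beta], intro ballI)
        fix u assume u: "u \<in> nodes T"
        have "(\<Sum>v\<in>nodes T. ?f (tree_dist (T @ [u]) 0 v)) = depth_exp_sum \<mu> T"
          unfolding depth_exp_sum_def by (intro sum.cong) (auto simp: tree_dist_snoc_old T u)
        then show "depth_exp_sum \<mu> (T @ [u]) = depth_exp_sum \<mu> T + exp \<mu> * ?f (tree_dist T 0 u)"
          unfolding depth_exp_sum_def[of \<mu> "T @ [u]"] using new_notin_nodes[of T]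
            tree_dist_snoc_new[OF T(1) u root_in_nodes] T(2)
          by (simp add: nodes_snoc distrib_left flip: exp_add)
      qed
    qed auto
    also have "\<dots> = depth_exp_sum \<mu> T +
        exp \<mu> * measure_pmf.expectation (attach \<beta> T) (\<lambda>u. ?f (tree_dist T 0 u))"
      by (subst Bochner_Integration.integral_add) (auto intro: integrable_attach[OF beta])
    also have "measure_pmf.expectation (attach \<beta> T) (\<lambda>u. ?f (tree_dist T 0 u)) =
        (depth_exp_sum \<mu> T + \<beta> * (\<Sum>i<length T. ?f (tree_dist T 0 (T ! i)))) / total_weight \<beta> k"
      by (simp add: expectation_attach[OF beta T(1)] T(2) total_weight_def depth_exp_sum_def)
    also have "\<dots> \<le> (depth_exp_sum \<mu> T + \<beta> * depth_exp_sum \<mu> T) / (real k + 1)"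
    proof (intro frac_le add_left_mono mult_left_mono beta)
      have "mono ?f"
        using assms by (auto intro!: monoI mult_left_mono)
      then show "(\<Sum>i<length T. ?f (tree_dist T 0 (T ! i))) \<le> depth_exp_sum \<mu> T"
        unfolding depth_exp_sum_def by (intro sum_parent_depth_le T) auto
    qed (use beta depth_exp_sum_nonneg[of \<mu> T] total_weight_ge[OF beta, of k] in auto)
    also have "depth_exp_sum \<mu> T + exp \<mu> * \<dots> = (1 + ?B / (real k + 1)) * depth_exp_sum \<mu> T"
      by (simp add: algebra_simps add_divide_distrib)
    finally show ?thesis by (simp add: mult_left_mono)
  qed
  have "measure_pmf.expectation (grow \<beta> (Suc k)) (depth_exp_sum \<mu>) \<le>
      measure_pmf.expectation (grow \<beta> k) (\<lambda>T. (1 + ?B / (real k + 1)) * depth_exp_sum \<mu> T)"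
    unfolding expectation_grow_Suc[OF beta] by (intro expectation_grow_mono[OF beta] step)
  also have "\<dots> = (1 + ?B / (real k + 1)) * measure_pmf.expectation (grow \<beta> k) (depth_exp_sum \<mu>)"
    by simp
  also have "\<dots> \<le> exp (?B / (real k + 1)) * exp (?B * harm k)"
    using beta by (intro mult_mono Suc.IH exp_ge_add_one_self integral_nonneg_AE)
      (auto simp: depth_exp_sum_nonneg)
  also have "\<dots> = exp (?B / (real k + 1) + ?B * harm k)"
    by (simp only: exp_add)
  also have "?B / (real k + 1) + ?B * harm k = ?B * harm (Suc k)"
    by (simp add: harm_Suc divide_inverse algebra_simps)
  finally show ?case .
qed

lemma prob_depth_le:
  assumes "\<mu> \<ge> 0"
  shows "measure_pmf.prob (grow \<beta> k) {T. \<not> depth_le h T} \<le>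
    exp ((1 + \<beta>) * exp \<mu> * harm k - \<mu> * h)"
proof -
  have "measure_pmf.prob (grow \<beta> k) {T. \<not> depth_le h T} =
      measure_pmf.expectation (grow \<beta> k) (indicator {T. \<not> depth_le h T})"
    by simp
  also have "\<dots> \<le> measure_pmf.expectation (grow \<beta> k) (\<lambda>T. exp (- (\<mu> * h)) * depth_exp_sum \<mu> T)"
  proof (rule expectation_grow_mono[OF beta])
    fix T
    have "1 \<le> exp (- (\<mu> * h)) * depth_exp_sum \<mu> T" if "\<not> depth_le h T"
      using depth_exp_sum_ge[OF assms that] by (simp add: exp_minus field_simps)
    then show "indicator {T. \<not> depth_le h T} T \<le> exp (- (\<mu> * h)) * depth_exp_sum \<mu> T"
      using depth_exp_sum_nonneg[of \<mu> T] by (cases "depth_le h T") simp_all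
  qed
  also have "\<dots> = exp (- (\<mu> * h)) * measure_pmf.expectation (grow \<beta> k) (depth_exp_sum \<mu>)"
    by simp
  also have "\<dots> \<le> exp (- (\<mu> * h)) * exp ((1 + \<beta>) * exp \<mu> * harm k)"
    by (intro mult_left_mono expectation_depth_exp_sum_le assms) auto
  also have "\<dots> = exp ((1 + \<beta>) * exp \<mu> * harm k - \<mu> * h)"
    by (simp add: mult_exp_exp)
  finally show ?thesis .
qed

end

section \<open>Exponential moments of the Wiener index\<close>

text \<open>
  A solution of \<open>a (k + 1) = a k * (1 + 2 * (1 + \<beta>) / total_weight \<beta> k)\<close>, which is the part of the
  recursion for the mean that is linear in the Wiener index.
\<close>

definition wiener_scale :: "real \<Rightarrow> nat \<Rightarrow> real" where
  "wiener_scale \<beta> k = (real k + root_offset \<beta>) * (real k + 1 + root_offset \<beta>)"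

definition scaled_wiener :: "real \<Rightarrow> nat \<Rightarrow> rtree \<Rightarrow> real" where
  "scaled_wiener \<beta> k T = (real (wiener_index T) - mean_wiener \<beta> k) / wiener_scale \<beta> k"

lemma Hoeffding_finite_pmf:
  fixes f :: "'a \<Rightarrow> real" and p :: "'a pmf"
  assumes "finite (set_pmf p)" "\<And>x. x \<in> set_pmf p \<Longrightarrow> f x \<in> {a..b}" "l > 0"
  shows "measure_pmf.expectation p (\<lambda>x. exp (l * (f x - measure_pmf.expectation p f))) \<le>
    exp (l\<^sup>2 * (b - a)\<^sup>2 / 8)"
proof -
  interpret interval_bounded_random_variable "measure_pmf p" f a b
  proof unfold_locales
    show "AE x in measure_pmf p. f x \<in> {a..b}"
      using assms(2) by (simp only: AE_measure_pmf_iff) blast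
  qed simp
  let ?g = "\<lambda>x. exp (l * (f x - measure_pmf.expectation p f))"
  have "ennreal (measure_pmf.expectation p ?g) = nn_integral p (\<lambda>x. ennreal (?g x))"
    by (rule nn_integral_eq_integral[symmetric])
      (use assms(1) in \<open>simp_all add: integrable_measure_pmf_finite\<close>)
  also have "\<dots> \<le> ennreal (exp (l\<^sup>2 * (b - a)\<^sup>2 / 8))"
    by (rule Hoeffdings_lemma_nn_integral[OF assms(3)])
  finally show ?thesis
    by (simp add: ennreal_le_iff)
qed

text \<open>
  Height constraints at two times. They are inherited by earlier trees with at least \<open>m\<close> insertions, which makes the
  restriction to tame trees compatible with induction along the growth.
\<close>

definition tame :: "nat \<Rightarrow> real \<Rightarrow> real \<Rightarrow> rtree \<Rightarrow> bool" where
  "tame m h\<^sub>0 h T \<longleftrightarrow> depth_le h T \<and> depth_le h\<^sub>0 (take m T)"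

context
  fixes \<beta> :: real
  assumes beta: "\<beta> \<ge> 0"
begin

lemma wiener_scale_pos: "wiener_scale \<beta> k > 0"
  using root_offset[OF beta] by (simp add: wiener_scale_def add_nonneg_pos)

lemma wiener_scale_Suc:
  "wiener_scale \<beta> (Suc k) = wiener_scale \<beta> k * (1 + 2 * (1 + \<beta>) / total_weight \<beta> k)"
proof -
  let ?a = "real k + root_offset \<beta>"
  have a: "?a > 0"
    using root_offset[OF beta] by simp
  have "2 * (1 + \<beta>) / total_weight \<beta> k = 2 * (1 / ?a)"
    by (simp flip: total_weight_ratio[OF beta])
  then have "wiener_scale \<beta> k * (1 + 2 * (1 + \<beta>) / total_weight \<beta> k) =
      (?a * (1 + 2 * (1 / ?a))) * (?a + 1)"
    by (simp add: wiener_scale_def add_ac mult_ac)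
  also have "?a * (1 + 2 * (1 / ?a)) = ?a + 2"
  proof -
    have "z * (1 + 2 * (1 / z)) = z + 2" if "z > 0" for z :: real
      using that by (simp add: field_simps)
    then show ?thesis
      using a by blast
  qed
  finally have "wiener_scale \<beta> k * (1 + 2 * (1 + \<beta>) / total_weight \<beta> k) = (?a + 2) * (?a + 1)" .
  also have "\<dots> = wiener_scale \<beta> (Suc k)"
    by (simp add: wiener_scale_def add_ac mult_ac)
  finally show ?thesis ..
qed

lemma wiener_scale_le: "wiener_scale \<beta> k \<le> (real k + 1) * (real k + 2)"
  unfolding wiener_scale_def using root_offset[OF beta] by (intro mult_mono) auto

lemma wiener_scale_ge: "wiener_scale \<beta> k \<ge> real k * (real k + 1)"
  unfolding wiener_scale_def using root_offset[OF beta] by (intro mult_mono) auto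

text \<open>
  A martingale difference plus a drift. The drift comes from the path length and carries an extra factor of order \<open>1 /
  n\<close>.
\<close>

lemma scaled_wiener_snoc:
  assumes "recursive_tree T" "u \<in> nodes T" "length T = k"
  shows "scaled_wiener \<beta> (Suc k) (T @ [u]) = scaled_wiener \<beta> k T +
    (real (dist_sum T u) - measure_pmf.expectation (attach \<beta> T) (\<lambda>u. real (dist_sum T u)))
      / wiener_scale \<beta> (Suc k) +
    \<beta> * (real (dist_sum T 0) - mean_path_length \<beta> k) / (total_weight \<beta> k * wiener_scale \<beta> (Suc k))"
proof -
  let ?s = "total_weight \<beta> k" and ?A = "wiener_scale \<beta> k" and ?A' = "wiener_scale \<beta> (Suc k)"
  let ?q = "1 + 2 * (1 + \<beta>) / ?s"
  let ?R = "real (dist_sum T u) - measure_pmf.expectation (attach \<beta> T) (\<lambda>u. real (dist_sum T u))"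
  have A: "?A > 0" "?A' > 0" "?A' = ?A * ?q"
    by (rule wiener_scale_pos wiener_scale_Suc)+
  then have q: "?q > 0"
    using zero_less_mult_pos[of ?A ?q] by simp
  have W: "real (wiener_index (T @ [u])) = real (wiener_index T) + real (dist_sum T u) + (real k + 1)"
    using assms by (simp add: wiener_index_snoc)
  define q r e where defs: "q = 2 * (1 + \<beta>) / ?s" "r = \<beta> / ?s" "e = (real k + 1)\<^sup>2 / ?s"
  have "measure_pmf.expectation (attach \<beta> T) (\<lambda>u. real (dist_sum T u)) + (real k + 1) =
      real (wiener_index T) * q + r * real (dist_sum T 0) + e"
    using expectation_attach_wiener_increment[OF beta assms(1)] by (simp only: assms(3) defs)
  moreover have "mean_wiener \<beta> (Suc k) = mean_wiener \<beta> k * (1 + q) + r * mean_path_length \<beta> k + e"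
    by (simp only: mean_wiener_Suc[OF beta] defs)
  ultimately have "real (wiener_index (T @ [u])) - mean_wiener \<beta> (Suc k) =
      (real (wiener_index T) - mean_wiener \<beta> k) * (1 + q) + ?R +
      r * (real (dist_sum T 0) - mean_path_length \<beta> k)"
    unfolding W by (simp add: algebra_simps)
  then have "real (wiener_index (T @ [u])) - mean_wiener \<beta> (Suc k) =
      (real (wiener_index T) - mean_wiener \<beta> k) * ?q + ?R +
      \<beta> / ?s * (real (dist_sum T 0) - mean_path_length \<beta> k)"
    by (simp only: defs)
  then have "scaled_wiener \<beta> (Suc k) (T @ [u]) =
      (real (wiener_index T) - mean_wiener \<beta> k) * ?q / ?A' + ?R / ?A' +
      \<beta> / ?s * (real (dist_sum T 0) - mean_path_length \<beta> k) / ?A'"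
    by (simp only: scaled_wiener_def add_divide_distrib)
  moreover have "(real (wiener_index T) - mean_wiener \<beta> k) * ?q / ?A' = scaled_wiener \<beta> k T"
    unfolding A(3) scaled_wiener_def using q by simp
  ultimately show ?thesis
    by simp
qed

text \<open>
  In a tree of height at most \<open>h\<close> the martingale difference ranges over an interval of length at most \<open>2 h / (k
  + 2)\<close>, so Hoeffding's lemma costs at most \<open>\<theta>\<^sup>2 h\<^sup>2 / ((k + 1) (k + 2))\<close> in the exponent;
  the drift costs \<open>\<theta> \<beta> h / ((k + 1) (k + 2))\<close>. The factor \<open>1 / ((k + 1) (k + 2))\<close> is
  written as a difference in order to telescope. The sign \<open>\<sigma>\<close> selects the upper or the lower tail.
\<close>

lemma exp_scaled_wiener_step:
  assumes T: "recursive_tree T" "length T = k" "depth_le h T"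
    and h: "harm k \<le> h" and "\<theta> > 0" and \<sigma>: "\<sigma> = 1 \<or> \<sigma> = - 1"
  shows "measure_pmf.expectation (attach \<beta> T)
      (\<lambda>u. exp (\<theta> * (\<sigma> * scaled_wiener \<beta> (Suc k) (T @ [u])))) \<le>
    exp (\<theta> * (\<sigma> * scaled_wiener \<beta> k T) +
      (\<theta> * \<beta> * h + \<theta>\<^sup>2 * h\<^sup>2) * (1 / (real k + 1) - 1 / (real k + 2)))"
proof -
  let ?s = "total_weight \<beta> k" and ?A' = "wiener_scale \<beta> (Suc k)"
  let ?E = "measure_pmf.expectation (attach \<beta> T)"
  let ?x = "real k"
  define drift where "drift = \<beta> * (real (dist_sum T 0) - mean_path_length \<beta> k) / (?s * ?A')"
  define l where "l = \<theta> / ?A'"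
  define c where "c = (?x + 1) * (2 * h)"
  define f where "f = (\<lambda>u. \<sigma> * real (dist_sum T u))"
  have A': "?A' > 0" "?A' \<ge> (?x + 1) * (?x + 2)"
    using wiener_scale_pos wiener_scale_ge[of "Suc k"] by (auto simp: add_ac)
  have s: "?s \<ge> ?x + 1"
    by (rule total_weight_ge[OF beta])
  have "h \<ge> 0"
    using h harm_nonneg[of k, where 'a = real] by linarith
  have l: "l > 0"
    unfolding l_def using A' assms by simp
  have c: "c \<ge> 0"
    unfolding c_def using \<open>h \<ge> 0\<close> by simp
  have Ef: "?E f = \<sigma> * ?E (\<lambda>u. real (dist_sum T u))"
    by (simp add: f_def)
  have "?E (\<lambda>u. exp (l * (f u - ?E f))) \<le> exp (l\<^sup>2 * (max 0 (\<sigma> * c) - min 0 (\<sigma> * c))\<^sup>2 / 8)"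
  proof (rule Hoeffding_finite_pmf)
    fix u assume "u \<in> set_pmf (attach \<beta> T)"
    then have "real (dist_sum T u) \<le> c"
      unfolding c_def using dist_sum_le[OF T(1,3), of u] T(2) by (simp add: set_pmf_attach[OF beta])
    then show "f u \<in> {min 0 (\<sigma> * c)..max 0 (\<sigma> * c)}"
      using \<sigma> by (auto simp: f_def)
  qed (use l in \<open>simp_all add: set_pmf_attach[OF beta]\<close>)
  also have "max 0 (\<sigma> * c) - min 0 (\<sigma> * c) = c"
    using \<sigma> c by auto
  finally have Hoeffding: "?E (\<lambda>u. exp (l * (f u - ?E f))) \<le> exp (l\<^sup>2 * c\<^sup>2 / 8)" .
  have "?E (\<lambda>u. exp (\<theta> * (\<sigma> * scaled_wiener \<beta> (Suc k) (T @ [u])))) =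
      ?E (\<lambda>u. exp (\<theta> * (\<sigma> * scaled_wiener \<beta> k T) + \<theta> * \<sigma> * drift) * exp (l * (f u - ?E f)))"
  proof (intro integral_cong_AE)
    show "AE u in attach \<beta> T. exp (\<theta> * (\<sigma> * scaled_wiener \<beta> (Suc k) (T @ [u]))) =
        exp (\<theta> * (\<sigma> * scaled_wiener \<beta> k T) + \<theta> * \<sigma> * drift) * exp (l * (f u - ?E f))"
      unfolding AE_measure_pmf_iff
    proof
      fix u assume "u \<in> set_pmf (attach \<beta> T)"
      then have u: "u \<in> nodes T"
        by (simp add: set_pmf_attach[OF beta])
      have "l * (f u - ?E f) = \<theta> * (\<sigma> *
          ((real (dist_sum T u) - ?E (\<lambda>u. real (dist_sum T u))) / ?A'))"
        unfolding l_def Ef by (simp add: f_def right_diff_distrib diff_divide_distrib)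
      then have "\<theta> * (\<sigma> * scaled_wiener \<beta> (Suc k) (T @ [u])) =
          \<theta> * (\<sigma> * scaled_wiener \<beta> k T) + \<theta> * \<sigma> * drift + l * (f u - ?E f)"
        unfolding scaled_wiener_snoc[OF T(1) u T(2)] drift_def by (simp only: distrib_left mult.assoc)
      then show "exp (\<theta> * (\<sigma> * scaled_wiener \<beta> (Suc k) (T @ [u]))) =
          exp (\<theta> * (\<sigma> * scaled_wiener \<beta> k T) + \<theta> * \<sigma> * drift) * exp (l * (f u - ?E f))"
        by (simp only: exp_add)
    qed
  qed simp_all
  also have "\<dots> = exp (\<theta> * (\<sigma> * scaled_wiener \<beta> k T) + \<theta> * \<sigma> * drift) * ?E (\<lambda>u. exp (l * (f u - ?E f)))"
    by simp
  also have "\<dots> \<le> exp (\<theta> * (\<sigma> * scaled_wiener \<beta> k T) + \<theta> * \<sigma> * drift) * exp (l\<^sup>2 * c\<^sup>2 / 8)"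
    by (intro mult_left_mono Hoeffding) simp
  also have "\<dots> = exp (\<theta> * (\<sigma> * scaled_wiener \<beta> k T) + (\<theta> * \<sigma> * drift + l\<^sup>2 * c\<^sup>2 / 8))"
    by (simp only: mult_exp_exp add.assoc)
  also have "\<dots> \<le> exp (\<theta> * (\<sigma> * scaled_wiener \<beta> k T) +
      (\<theta> * \<beta> * h + \<theta>\<^sup>2 * h\<^sup>2) * (1 / (real k + 1) - 1 / (real k + 2)))"
  proof -
    have "\<bar>real (dist_sum T 0) - mean_path_length \<beta> k\<bar> \<le> (?x + 1) * h"
    proof -
      have "mean_path_length \<beta> k \<le> (?x + root_offset \<beta>) * harm k"
        by (rule mean_path_length_le[OF beta])
      also have "\<dots> \<le> (?x + 1) * h"
        using h root_offset[OF beta] by (intro mult_mono) (auto simp: harm_nonneg)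
      finally show ?thesis
        using path_length_le[OF T(1,3)] T(2) mean_path_length_nonneg[OF beta, of k] by (simp add: abs_if)
    qed
    then have "\<bar>drift\<bar> \<le> \<beta> * ((?x + 1) * h) / ((?x + 1) * ((?x + 1) * (?x + 2)))"
      unfolding drift_def abs_divide abs_mult using beta s A' \<open>h \<ge> 0\<close>
      by (intro frac_le mult_mono) auto
    also have "\<dots> = \<beta> * h / ((?x + 1) * (?x + 2))"
    proof -
      have "\<beta> * (y * h) / (y * z) = \<beta> * h / z" if "y > 0" for y z
        using that by simp
      from this[of "?x + 1"] show ?thesis
        by simp
    qed
    finally have "\<theta> * \<bar>drift\<bar> \<le> \<theta> * (\<beta> * h / ((?x + 1) * (?x + 2)))"
      using assms by (intro mult_left_mono) auto
    moreover have "\<theta> * \<sigma> * drift \<le> \<theta> * \<bar>drift\<bar>"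
      using \<sigma> assms(5) by (auto simp: mult_le_cancel_left)
    ultimately have 1: "\<theta> * \<sigma> * drift \<le> \<theta> * \<beta> * h / ((?x + 1) * (?x + 2))"
      by simp
    have "l * c \<le> \<theta> / ((?x + 1) * (?x + 2)) * c"
      unfolding l_def using A' assms(5) c by (intro mult_right_mono divide_left_mono) auto
    also have "\<dots> = \<theta> * (2 * h) / (?x + 2)"
      unfolding c_def
    proof -
      have "\<theta> / (y * z) * (y * h') = \<theta> * h' / z" if "y > 0" for y z h' :: real
        using that by simp
      from this[of "?x + 1"] show "\<theta> / ((?x + 1) * (?x + 2)) * ((?x + 1) * (2 * h)) = \<theta> * (2 * h) / (?x + 2)"
        by simp
    qed
    finally have "(l * c)\<^sup>2 \<le> (\<theta> * (2 * h) / (?x + 2))\<^sup>2"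
      using l c by (intro power_mono) auto
    then have "l\<^sup>2 * c\<^sup>2 / 8 \<le> (\<theta> * (2 * h) / (?x + 2))\<^sup>2 / 8"
      by (simp add: power_mult_distrib)
    also have "\<dots> = \<theta>\<^sup>2 * h\<^sup>2 / (2 * (?x + 2)\<^sup>2)"
      by (simp add: power_mult_distrib power_divide)
    also have "\<dots> \<le> \<theta>\<^sup>2 * h\<^sup>2 / ((?x + 1) * (?x + 2))"
    proof (intro divide_left_mono)
      have "(?x + 1) * (?x + 2) \<le> (?x + 2) * (?x + 2)"
        by (intro mult_right_mono) auto
      also have "\<dots> \<le> 2 * (?x + 2)\<^sup>2"
        by (simp add: power2_eq_square)
      finally show "(?x + 1) * (?x + 2) \<le> 2 * (?x + 2)\<^sup>2" .
    qed simp_all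
    finally have 2: "l\<^sup>2 * c\<^sup>2 / 8 \<le> \<theta>\<^sup>2 * h\<^sup>2 / ((?x + 1) * (?x + 2))" .
    have "1 / (?x + 1) - 1 / (?x + 2) = 1 / ((?x + 1) * (?x + 2))"
      by (simp add: divide_simps)
    then have "(\<theta> * \<beta> * h + \<theta>\<^sup>2 * h\<^sup>2) * (1 / (?x + 1) - 1 / (?x + 2)) =
        \<theta> * \<beta> * h / ((?x + 1) * (?x + 2)) + \<theta>\<^sup>2 * h\<^sup>2 / ((?x + 1) * (?x + 2))"
      by (simp add: add_divide_distrib)
    then show ?thesis
      using 1 2 by (simp only: exp_le_cancel_iff add_left_mono add_mono)
  qed
  finally show ?thesis .
qed

text \<open>
  The crude bound used for the initial phase: a distance is at most the sum of two depths, both for the tree itself and on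
  average.
\<close>

lemma abs_scaled_wiener_le:
  assumes T: "recursive_tree T" "length T = m" "depth_le h T" and h: "harm m \<le> h" and "m \<ge> 1"
  shows "\<bar>scaled_wiener \<beta> m T\<bar> \<le> 2 * h"
proof -
  let ?x = "real m"
  have "h \<ge> 0"
    using h harm_nonneg[of m, where 'a = real] by linarith
  have "real (wiener_index T) \<le> real (Suc (length T) * dist_sum T 0)"
    using wiener_index_le_path_length[OF T(1)] by (simp only: of_nat_le_iff)
  also have "\<dots> \<le> (?x + 1) * ((?x + 1) * h)"
  proof -
    have "real (Suc (length T) * dist_sum T 0) = (?x + 1) * real (dist_sum T 0)"
      by (simp add: T(2) algebra_simps)
    also have "\<dots> \<le> (?x + 1) * ((?x + 1) * h)"
      using path_length_le[OF T(1,3)] T(2) by (intro mult_left_mono) auto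
    finally show ?thesis .
  qed
  finally have W: "real (wiener_index T) \<le> (?x + 1) * ((?x + 1) * h)" .
  have "mean_wiener \<beta> m \<le> measure_pmf.expectation (grow \<beta> m) (\<lambda>T. (?x + 1) * real (dist_sum T 0))"
    unfolding mean_wiener_def
  proof (rule expectation_grow_mono[OF beta])
    fix T assume T: "recursive_tree T" "length T = m"
    have "real (wiener_index T) \<le> real (Suc (length T) * dist_sum T 0)"
      using wiener_index_le_path_length[OF T(1)] by (simp only: of_nat_le_iff)
    also have "\<dots> = (?x + 1) * real (dist_sum T 0)"
      by (simp add: T(2) algebra_simps)
    finally show "real (wiener_index T) \<le> (?x + 1) * real (dist_sum T 0)" .
  qed
  also have "\<dots> = (?x + 1) * mean_path_length \<beta> m"
    by (simp add: mean_path_length_def)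
  also have "\<dots> \<le> (?x + 1) * ((?x + root_offset \<beta>) * harm m)"
    by (intro mult_left_mono mean_path_length_le[OF beta]) simp
  also have "\<dots> \<le> (?x + 1) * ((?x + 1) * h)"
    using h root_offset[OF beta] by (intro mult_left_mono mult_mono) (auto simp: harm_nonneg)
  finally have "\<bar>real (wiener_index T) - mean_wiener \<beta> m\<bar> \<le> (?x + 1) * ((?x + 1) * h)"
    using W mean_wiener_nonneg[OF beta, of m] by (simp add: abs_if)
  also have "\<dots> \<le> (?x + 1) * (2 * ?x * h)"
    using \<open>m \<ge> 1\<close> \<open>h \<ge> 0\<close> by (intro mult_left_mono mult_right_mono) auto
  also have "\<dots> = 2 * h * (?x * (?x + 1))"
    by (simp add: mult_ac)
  also have "\<dots> \<le> 2 * h * wiener_scale \<beta> m"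
    using \<open>h \<ge> 0\<close> by (intro mult_left_mono wiener_scale_ge) auto
  finally show ?thesis
    using wiener_scale_pos[of m] by (simp add: scaled_wiener_def abs_divide pos_divide_le_eq)
qed

lemma expectation_grow_take:
  fixes f :: "rtree \<Rightarrow> real"
  shows "measure_pmf.expectation (grow \<beta> (m + j)) (\<lambda>T. f (take m T)) =
    measure_pmf.expectation (grow \<beta> m) f"
proof (induction j)
  case 0
  show ?case by (simp, intro expectation_grow_cong[OF beta]) simp
next
  case (Suc j)
  have "measure_pmf.expectation (grow \<beta> (m + Suc j)) (\<lambda>T. f (take m T)) =
      measure_pmf.expectation (grow \<beta> (m + j)) (\<lambda>T. f (take m T))"
    unfolding add_Suc_right expectation_grow_Suc[OF beta]
    by (intro expectation_grow_cong[OF beta]) simp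
  then show ?case using Suc.IH by simp
qed

text \<open>
  The first \<open>m\<close> insertions cost \<open>2 \<theta> h\<^sub>0\<close>, and the costs of all later ones telescope to at
  most \<open>(\<theta> \<beta> h + \<theta>\<^sup>2 h\<^sup>2) / (m + 1)\<close>.
\<close>

lemma exp_scaled_wiener_tame_le:
  assumes "harm (m + j) \<le> h" "harm m \<le> h\<^sub>0" "m \<ge> 1" "\<theta> > 0" and \<sigma>: "\<sigma> = 1 \<or> \<sigma> = - 1"
  shows "measure_pmf.expectation (grow \<beta> (m + j))
      (\<lambda>T. if tame m h\<^sub>0 h T then exp (\<theta> * (\<sigma> * scaled_wiener \<beta> (m + j) T)) else 0) \<le>
    exp (2 * \<theta> * h\<^sub>0 + (\<theta> * \<beta> * h + \<theta>\<^sup>2 * h\<^sup>2) * (1 / (real m + 1) - 1 / (real (m + j) + 1)))"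
  using assms(1)
proof (induction j)
  case 0
  have "measure_pmf.expectation (grow \<beta> (m + 0))
      (\<lambda>T. if tame m h\<^sub>0 h T then exp (\<theta> * (\<sigma> * scaled_wiener \<beta> (m + 0) T)) else 0) \<le>
      measure_pmf.expectation (grow \<beta> (m + 0)) (\<lambda>_. exp (2 * \<theta> * h\<^sub>0))"
  proof (rule expectation_grow_mono[OF beta])
    fix T assume T: "recursive_tree T" "length T = m + 0"
    have "exp (\<theta> * (\<sigma> * scaled_wiener \<beta> m T)) \<le> exp (2 * \<theta> * h\<^sub>0)" if "tame m h\<^sub>0 h T"
    proof -
      have "\<bar>scaled_wiener \<beta> m T\<bar> \<le> 2 * h\<^sub>0"
        using that T assms by (intro abs_scaled_wiener_le) (auto simp: tame_def)
      then have "\<sigma> * scaled_wiener \<beta> m T \<le> 2 * h\<^sub>0"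
        using \<sigma> by auto
      then have "\<theta> * (\<sigma> * scaled_wiener \<beta> m T) \<le> \<theta> * (2 * h\<^sub>0)"
        using assms(4) by (intro mult_left_mono) auto
      then show ?thesis
        by (simp add: mult_ac)
    qed
    then show "(if tame m h\<^sub>0 h T then exp (\<theta> * (\<sigma> * scaled_wiener \<beta> (m + 0) T)) else 0)
        \<le> exp (2 * \<theta> * h\<^sub>0)"
      by simp
  qed
  then show ?case by simp
next
  case (Suc j)
  let ?C = "\<theta> * \<beta> * h + \<theta>\<^sup>2 * h\<^sup>2"
  let ?x = "real (m + j)"
  let ?g = "\<lambda>k T. if tame m h\<^sub>0 h T then exp (\<theta> * (\<sigma> * scaled_wiener \<beta> k T)) else 0"
  let ?d = "?C * (1 / (?x + 1) - 1 / (?x + 2))"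
  have harm: "harm (m + j) \<le> h"
    using Suc.prems harm_mono[of "m + j" "m + Suc j", where 'a = real] by simp
  have "measure_pmf.expectation (grow \<beta> (m + Suc j)) (?g (m + Suc j)) \<le>
      measure_pmf.expectation (grow \<beta> (m + j)) (\<lambda>T. exp ?d * ?g (m + j) T)"
    unfolding add_Suc_right expectation_grow_Suc[OF beta]
  proof (rule expectation_grow_mono[OF beta])
    fix T assume T: "recursive_tree T" "length T = m + j"
    have mono: "tame m h\<^sub>0 h T" if "u \<in> nodes T" "tame m h\<^sub>0 h (T @ [u])" for u
      using that T depth_le_snoc[OF T(1)] by (auto simp: tame_def)
    show "measure_pmf.expectation (attach \<beta> T) (\<lambda>u. ?g (Suc (m + j)) (T @ [u])) \<le>
        exp ?d * ?g (m + j) T"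
    proof (cases "tame m h\<^sub>0 h T")
      case True
      have "measure_pmf.expectation (attach \<beta> T) (\<lambda>u. ?g (Suc (m + j)) (T @ [u])) \<le>
          measure_pmf.expectation (attach \<beta> T)
            (\<lambda>u. exp (\<theta> * (\<sigma> * scaled_wiener \<beta> (Suc (m + j)) (T @ [u]))))"
        by (intro integral_mono integrable_attach[OF beta]) auto
      also have "\<dots> \<le> exp (\<theta> * (\<sigma> * scaled_wiener \<beta> (m + j) T) + ?d)"
        using True T harm \<sigma> assms(4) by (intro exp_scaled_wiener_step) (auto simp: tame_def)
      also have "\<dots> = exp ?d * ?g (m + j) T"
        using True by (simp add: mult_exp_exp add.commute)
      finally show ?thesis .
    next
      case False
      have "measure_pmf.expectation (attach \<beta> T) (\<lambda>u. ?g (Suc (m + j)) (T @ [u])) =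
          measure_pmf.expectation (attach \<beta> T) (\<lambda>_. 0)"
        by (intro integral_cong_AE)
          (use False mono in \<open>auto simp: AE_measure_pmf_iff set_pmf_attach[OF beta]\<close>)
      then show ?thesis
        using False by simp
    qed
  qed
  also have "\<dots> = exp ?d * measure_pmf.expectation (grow \<beta> (m + j)) (?g (m + j))"
    by simp
  also have "\<dots> \<le> exp ?d * exp (2 * \<theta> * h\<^sub>0 + ?C * (1 / (real m + 1) - 1 / (?x + 1)))"
    by (intro mult_left_mono Suc.IH harm) simp
  also have "\<dots> = exp (2 * \<theta> * h\<^sub>0 + (?d + ?C * (1 / (real m + 1) - 1 / (?x + 1))))"
    by (simp add: mult_exp_exp)
  also have "?d + ?C * (1 / (real m + 1) - 1 / (?x + 1)) = ?C * (1 / (real m + 1) - 1 / (?x + 2))"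
    by (simp only: distrib_left[symmetric]) simp
  also have "?x + 2 = real (m + Suc j) + 1"
    by simp
  finally show ?case .
qed

text \<open>
  Either one of the two height constraints fails, or the exponential moment bound applies to one of the two tails.
\<close>

lemma wiener_tail_bound:
  assumes "harm (m + j) \<le> h" "harm m \<le> h\<^sub>0" "m \<ge> 1" "\<theta> > 0" "\<mu> \<ge> 0"
    and y: "y * wiener_scale \<beta> (m + j) \<le> t * mean_wiener \<beta> (m + j)"
  shows "measure_pmf.prob (grow \<beta> (m + j))
      {T. \<bar>real (wiener_index T) - mean_wiener \<beta> (m + j)\<bar> > t * mean_wiener \<beta> (m + j)} \<le>
    exp ((1 + \<beta>) * exp \<mu> * harm m - \<mu> * h\<^sub>0) +
    exp ((1 + \<beta>) * exp 1 * harm (m + j) - h) +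
    2 * exp (2 * \<theta> * h\<^sub>0 - \<theta> * y + (\<theta> * \<beta> * h + \<theta>\<^sup>2 * h\<^sup>2) / (real m + 1))"
proof -
  let ?p = "grow \<beta> (m + j)"
  let ?B = "{T. \<bar>real (wiener_index T) - mean_wiener \<beta> (m + j)\<bar> > t * mean_wiener \<beta> (m + j)}"
  let ?g = "\<lambda>\<sigma> T. if tame m h\<^sub>0 h T then exp (\<theta> * (\<sigma> * scaled_wiener \<beta> (m + j) T)) else 0"
  let ?A = "wiener_scale \<beta> (m + j)"
  let ?C = "\<theta> * \<beta> * h + \<theta>\<^sup>2 * h\<^sup>2"
  let ?I = "\<lambda>h. (indicator {T. \<not> depth_le h T} :: rtree \<Rightarrow> real)"
  have "h \<ge> 0"
    using assms(1) harm_nonneg[of "m + j", where 'a = real] by linarith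
  have C: "?C \<ge> 0"
    using beta assms \<open>h \<ge> 0\<close> by simp
  have g: "measure_pmf.expectation ?p (?g \<sigma>) \<le> exp (2 * \<theta> * h\<^sub>0 + ?C / (real m + 1))"
    if "\<sigma> = 1 \<or> \<sigma> = - 1" for \<sigma>
  proof -
    have "measure_pmf.expectation ?p (?g \<sigma>) \<le>
        exp (2 * \<theta> * h\<^sub>0 + ?C * (1 / (real m + 1) - 1 / (real (m + j) + 1)))"
      by (rule exp_scaled_wiener_tame_le) (use assms that in auto)
    also have "\<dots> \<le> exp (2 * \<theta> * h\<^sub>0 + ?C * (1 / (real m + 1)))"
      using C by (intro iffD2[OF exp_le_cancel_iff] add_left_mono mult_left_mono) auto
    finally show ?thesis by simp
  qed
  have "measure_pmf.prob ?p ?B = measure_pmf.expectation ?p (indicator ?B)"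
    by simp
  also have "\<dots> \<le> measure_pmf.expectation ?p
      (\<lambda>T. ?I h\<^sub>0 (take m T) + ?I h T + exp (- (\<theta> * y)) * (?g 1 T + ?g (- 1) T))"
  proof (rule expectation_grow_mono[OF beta])
    fix T
    have pos: "?g \<sigma> T \<ge> 0" for \<sigma>
      by simp
    have "1 \<le> exp (- (\<theta> * y)) * (?g 1 T + ?g (- 1) T)" if T: "T \<in> ?B" "tame m h\<^sub>0 h T"
    proof -
      have "y * ?A < \<bar>real (wiener_index T) - mean_wiener \<beta> (m + j)\<bar>"
        using y T by simp
      then have "y < \<bar>scaled_wiener \<beta> (m + j) T\<bar>"
        using wiener_scale_pos[of "m + j"]
        by (simp add: scaled_wiener_def abs_divide pos_less_divide_eq)
      then have "y \<le> 1 * scaled_wiener \<beta> (m + j) T \<or> y \<le> - 1 * scaled_wiener \<beta> (m + j) T"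
        by (auto simp: abs_if split: if_splits)
      then obtain \<sigma> :: real where \<sigma>: "\<sigma> = 1 \<or> \<sigma> = - 1" "y \<le> \<sigma> * scaled_wiener \<beta> (m + j) T"
        by blast
      then have "exp (\<theta> * y) \<le> ?g \<sigma> T"
        using T(2) assms(4) by simp
      also have "\<dots> \<le> ?g 1 T + ?g (- 1) T"
        using \<sigma>(1) pos[of 1] pos[of "- 1"] by auto
      finally show ?thesis
        by (simp add: exp_minus field_simps)
    qed
    moreover have "0 \<le> exp (- (\<theta> * y)) * (?g 1 T + ?g (- 1) T)"
      using pos[of 1] pos[of "- 1"] by (intro mult_nonneg_nonneg add_nonneg_nonneg) auto
    moreover have "tame m h\<^sub>0 h T \<or> ?I h\<^sub>0 (take m T) = 1 \<or> ?I h T = 1"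
      by (cases "depth_le h T"; cases "depth_le h\<^sub>0 (take m T)") (simp_all add: tame_def)
    moreover have "?I h\<^sub>0 (take m T) \<ge> 0" "?I h T \<ge> 0" "(indicator ?B T :: real) \<le> 1"
      by (auto simp: indicator_def)
    moreover have "(indicator ?B T :: real) = 0" if "T \<notin> ?B"
      using that by simp
    ultimately show "indicator ?B T \<le> ?I h\<^sub>0 (take m T) + ?I h T +
        exp (- (\<theta> * y)) * (?g 1 T + ?g (- 1) T)"
      by (cases "T \<in> ?B") linarith+
  qed
  also have "\<dots> = measure_pmf.expectation ?p (\<lambda>T. ?I h\<^sub>0 (take m T)) + measure_pmf.expectation ?p (?I h) +
      exp (- (\<theta> * y)) * (measure_pmf.expectation ?p (?g 1) + measure_pmf.expectation ?p (?g (- 1)))"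
    by (simp add: integrable_grow[OF beta] del: integral_indicator)
  also have "measure_pmf.expectation ?p (\<lambda>T. ?I h\<^sub>0 (take m T)) =
      measure_pmf.prob (grow \<beta> m) {T. \<not> depth_le h\<^sub>0 T}"
    by (simp add: expectation_grow_take)
  also have "measure_pmf.expectation ?p (?I h) = measure_pmf.prob ?p {T. \<not> depth_le h T}"
    by simp
  also have "measure_pmf.prob (grow \<beta> m) {T. \<not> depth_le h\<^sub>0 T} +
      measure_pmf.prob ?p {T. \<not> depth_le h T} +
      exp (- (\<theta> * y)) * (measure_pmf.expectation ?p (?g 1) + measure_pmf.expectation ?p (?g (- 1))) \<le>
    exp ((1 + \<beta>) * exp \<mu> * harm m - \<mu> * h\<^sub>0) + exp ((1 + \<beta>) * exp 1 * harm (m + j) - 1 * h) +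
      exp (- (\<theta> * y)) * (exp (2 * \<theta> * h\<^sub>0 + ?C / (real m + 1)) + exp (2 * \<theta> * h\<^sub>0 + ?C / (real m + 1)))"
    by (intro add_mono mult_left_mono prob_depth_le[OF beta] g assms) auto
  also have "exp (- (\<theta> * y)) *
      (exp (2 * \<theta> * h\<^sub>0 + ?C / (real m + 1)) + exp (2 * \<theta> * h\<^sub>0 + ?C / (real m + 1))) =
      2 * exp (- (\<theta> * y) + (2 * \<theta> * h\<^sub>0 + ?C / (real m + 1)))"
    by (simp only: exp_add[of "- (\<theta> * y)"] mult_2 distrib_left)
  also have "- (\<theta> * y) + (2 * \<theta> * h\<^sub>0 + ?C / (real m + 1)) = 2 * \<theta> * h\<^sub>0 - \<theta> * y + ?C / (real m + 1)"
    by simp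
  finally show ?thesis
    by simp
qed

end

section \<open>Asymptotics\<close>

lemma harm_le_ln: "n \<ge> 1 \<Longrightarrow> harm n \<le> 1 + ln (real n)"
proof -
  assume n: "n \<ge> 1"
  have "harm (Suc (n - 1)) - ln (real (Suc (n - 1))) \<le> harm (Suc 0) - ln (real (Suc 0))"
    by (rule decseqD[OF decseq_harm_diff_ln]) simp
  then show ?thesis
    using n by (simp add: harm_def)
qed

text \<open>
  With \<open>L = log n\<close> these expressions bound the three exponents of \<open>wiener_tail_bound\<close> for
  \<open>m\<close> equal to \<open>L\<^sup>4\<close> rounded up, \<open>h = L powr (3 / 2)\<close>, \<open>y = c L\<close>,
  \<open>h\<^sub>0 = y / 4\<close>, \<open>\<theta> = log L\<close> and \<open>\<mu> = log L / 2\<close>. In the first one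
  \<open>e\<^sup>\<mu> log m\<close> is \<open>o(L)\<close>, because \<open>e\<^sup>\<mu>\<close> is the square root of
  \<open>L\<close>; in the second one \<open>h\<close> outweighs both \<open>L\<close> and \<open>L log L\<close>; in the third
  one \<open>\<theta>\<^sup>2 h\<^sup>2 / m\<close> tends to 0. The summand \<open>ln 4\<close> in the target pays for adding up
  four such terms.
\<close>

lemma tail_exponents:
  fixes B \<beta> c :: real
  assumes "B > 0" "\<beta> \<ge> 0" "c > 0"
  defines "target \<equiv> (\<lambda>n::nat. - (c / 16) * ln (real n) * ln (ln (real n)) - ln 4)"
  shows "\<forall>\<^sub>F n in sequentially. B * exp (ln (ln (real n)) / 2) * (1 + ln (ln (real n) ^ 4 + 1))
           - ln (ln (real n)) / 2 * (c * ln (real n) / 4) \<le> target n"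
    and "\<forall>\<^sub>F n in sequentially. B * exp 1 * (1 + ln (real n)) - ln (real n) powr (3 / 2) \<le> target n"
    and "\<forall>\<^sub>F n in sequentially. 2 * ln (ln (real n)) * (c * ln (real n) / 4)
           - ln (ln (real n)) * (c * ln (real n))
           + (ln (ln (real n)) * \<beta> * ln (real n) powr (3 / 2)
              + (ln (ln (real n)))\<^sup>2 * (ln (real n) powr (3 / 2))\<^sup>2) / ln (real n) ^ 4 \<le> target n"
proof -
  show "\<forall>\<^sub>F n in sequentially. B * exp (ln (ln (real n)) / 2) * (1 + ln (ln (real n) ^ 4 + 1))
           - ln (ln (real n)) / 2 * (c * ln (real n) / 4) \<le> target n"
    unfolding target_def using assms(1-3) by real_asymp
  show "\<forall>\<^sub>F n in sequentially. B * exp 1 * (1 + ln (real n)) - ln (real n) powr (3 / 2) \<le> target n"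
    unfolding target_def using assms(1-3) by real_asymp
  have "((\<lambda>n. (ln (ln (real n)) * \<beta> * ln (real n) powr (3 / 2)
              + (ln (ln (real n)))\<^sup>2 * (ln (real n) powr (3 / 2))\<^sup>2) / ln (real n) ^ 4) \<longlongrightarrow> 0) sequentially"
    using assms(1-3) by real_asymp
  then have "\<forall>\<^sub>F n in sequentially. (ln (ln (real n)) * \<beta> * ln (real n) powr (3 / 2)
              + (ln (ln (real n)))\<^sup>2 * (ln (real n) powr (3 / 2))\<^sup>2) / ln (real n) ^ 4 < 1"
    by (rule order_tendstoD) simp
  moreover have "\<forall>\<^sub>F n in sequentially. 2 * ln (ln (real n)) * (c * ln (real n) / 4)
           - ln (ln (real n)) * (c * ln (real n)) + 1 \<le> target n"
    unfolding target_def using assms(1-3) by real_asymp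
  ultimately show "\<forall>\<^sub>F n in sequentially. 2 * ln (ln (real n)) * (c * ln (real n) / 4)
           - ln (ln (real n)) * (c * ln (real n))
           + (ln (ln (real n)) * \<beta> * ln (real n) powr (3 / 2)
              + (ln (ln (real n)))\<^sup>2 * (ln (real n) powr (3 / 2))\<^sup>2) / ln (real n) ^ 4 \<le> target n"
    by eventually_elim linarith
qed

lemma wiener_tail_eventually:
  fixes \<beta> t :: real
  assumes beta: "\<beta> \<ge> 0" and t: "t > 0"
  shows "\<forall>\<^sub>F n in sequentially. measure_pmf.prob (grow \<beta> (n - 1))
      {T. \<bar>real (wiener_index T) - mean_wiener \<beta> (n - 1)\<bar> > t * mean_wiener \<beta> (n - 1)} \<le>
    exp (- (t / (96 * (1 + \<beta>))) * ln (real n) * ln (ln (real n)))"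
proof -
  define B where "B = 1 + \<beta>"
  define c where "c = t / (6 * B)"
  have B: "B > 0" and c: "c > 0"
    using beta t by (auto simp: B_def c_def)
  have "\<forall>\<^sub>F n in sequentially. ln (real n) ^ 4 + 2 \<le> real n"
    by real_asymp
  moreover have "\<forall>\<^sub>F n in sequentially. ln (real n) \<ge> 3"
    by real_asymp
  moreover have "\<forall>\<^sub>F n in sequentially. 1 + ln (real n) \<le> ln (real n) powr (3 / 2)"
    by real_asymp
  moreover have "\<forall>\<^sub>F n in sequentially. 1 + ln (ln (real n) ^ 4 + 1) \<le> c * ln (real n) / 4"
    using c by real_asymp
  ultimately show ?thesis
    using tail_exponents[OF B beta c]
  proof eventually_elim
    case (elim n)
    define L where "L = ln (real n)"
    define m where "m = nat \<lceil>L ^ 4\<rceil>"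
    define j where "j = n - 1 - m"
    define h where "h = L powr (3 / 2)"
    note bounds = elim[folded L_def, folded h_def]
    have L: "L \<ge> 3" and "ln L > 0"
      using bounds(2) by auto
    then have L4: "L ^ 4 \<ge> 1"
      by (intro one_le_power) auto
    have m: "real m \<ge> L ^ 4" "real m \<le> L ^ 4 + 1"
      unfolding m_def using L4 by linarith+
    have "m \<ge> 1" "m + j = n - 1" "n \<ge> 1" "Suc (n - 1) = n"
      using m L4 bounds(1) by (auto simp: j_def)
    have harm_n: "harm (n - 1) \<le> 1 + L"
    proof -
      have "harm (n - 1) \<le> (harm n :: real)"
        by (rule harm_mono) simp
      also have "\<dots> \<le> 1 + L"
        unfolding L_def by (rule harm_le_ln) fact
      finally show ?thesis .
    qed
    have harm_m: "harm m \<le> 1 + ln (L ^ 4 + 1)"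
    proof -
      have "harm m \<le> 1 + ln (real m)"
        by (rule harm_le_ln) fact
      also have "\<dots> \<le> 1 + ln (L ^ 4 + 1)"
        using m L4 by (intro add_left_mono ln_mono) auto
      finally show ?thesis .
    qed
    have mean: "c * L * wiener_scale \<beta> (n - 1) \<le> t * mean_wiener \<beta> (n - 1)"
    proof -
      have n: "real (n - 1) + 1 = real n" "real (n - 1) + 2 = real n + 1"
        using \<open>n \<ge> 1\<close> by auto
      have "L \<le> ln (real n + 1)"
        unfolding L_def using \<open>n \<ge> 1\<close> by (intro ln_mono) auto
      also have "\<dots> \<le> harm n"
        by (rule ln_le_harm)
      finally have "L / 2 \<le> harm n - 1"
        using L by linarith
      have "c * L * wiener_scale \<beta> (n - 1) \<le> c * L * (real n * (real n + 1))"
        using wiener_scale_le[OF beta, of "n - 1"] c L unfolding n by (intro mult_left_mono) auto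
      also have "\<dots> = t * (real n * (real n + 1) * (L / 2 / (3 * B)))"
        by (simp add: c_def)
      also have "\<dots> \<le> t * (real n * (real n + 1) * ((harm n - 1) / (3 * B)))"
        using \<open>L / 2 \<le> harm n - 1\<close> t B by (intro mult_left_mono divide_right_mono) auto
      also have "\<dots> \<le> t * mean_wiener \<beta> (n - 1)"
        using mean_wiener_ge[OF beta, of "n - 1"] t \<open>Suc (n - 1) = n\<close>
        unfolding n B_def by (intro mult_left_mono) auto
      finally show ?thesis .
    qed
    let ?target = "- (c / 16) * L * ln L"
    have "measure_pmf.prob (grow \<beta> (n - 1))
        {T. \<bar>real (wiener_index T) - mean_wiener \<beta> (n - 1)\<bar> > t * mean_wiener \<beta> (n - 1)} \<le>
      exp (B * exp (ln L / 2) * harm m - ln L / 2 * (c * L / 4)) +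
      exp (B * exp 1 * harm (n - 1) - h) +
      2 * exp (2 * ln L * (c * L / 4) - ln L * (c * L) +
        (ln L * \<beta> * h + (ln L)\<^sup>2 * h\<^sup>2) / (real m + 1))"
      unfolding B_def \<open>m + j = n - 1\<close>[symmetric]
      by (rule wiener_tail_bound[OF beta])
        (use \<open>m + j = n - 1\<close> \<open>m \<ge> 1\<close> \<open>ln L > 0\<close> harm_n harm_m bounds mean in auto)
    also have "\<dots> \<le> exp (?target - ln 4) + exp (?target - ln 4) + 2 * exp (?target - ln 4)"
    proof (intro add_mono mult_left_mono iffD2[OF exp_le_cancel_iff])
      have "B * exp (ln L / 2) * harm m \<le> B * exp (ln L / 2) * (1 + ln (L ^ 4 + 1))"
        using harm_m B by (intro mult_left_mono) auto
      then show "B * exp (ln L / 2) * harm m - ln L / 2 * (c * L / 4) \<le> ?target - ln 4"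
        using bounds(5) by linarith
      have "B * exp 1 * harm (n - 1) \<le> B * exp 1 * (1 + L)"
        using harm_n B by (intro mult_left_mono) auto
      then show "B * exp 1 * harm (n - 1) - h \<le> ?target - ln 4"
        using bounds(6) by linarith
      have "(ln L * \<beta> * h + (ln L)\<^sup>2 * h\<^sup>2) / (real m + 1) \<le> (ln L * \<beta> * h + (ln L)\<^sup>2 * h\<^sup>2) / L ^ 4"
        using m L4 L beta \<open>ln L > 0\<close>
        by (intro divide_left_mono mult_pos_pos zero_less_power add_nonneg_nonneg mult_nonneg_nonneg)
          (auto simp: h_def)
      then show "2 * ln L * (c * L / 4) - ln L * (c * L) +
          (ln L * \<beta> * h + (ln L)\<^sup>2 * h\<^sup>2) / (real m + 1) \<le> ?target - ln 4"
        using bounds(7) by linarith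
    qed auto
    also have "\<dots> = exp ?target"
      by (simp add: exp_diff)
    finally show ?case
      by (simp add: L_def c_def B_def)
  qed
qed

theorem corollary1p5:
  fixes b :: nat
  assumes "b \<ge> 2"
  shows "\<exists>D::real. D > 0 \<and>
    (let \<alpha> = - ln (4 * D * (real b - 1) * exp 1);
         \<T> = (\<lambda>n. linear_recursive_tree (real b - 2) n);
         W = (\<lambda>T. real (wiener_index T));
         E = (\<lambda>n. measure_pmf.expectation (\<T> n) W)
     in \<forall>t::real. t > 0 \<longrightarrow>
       (\<exists>\<epsilon>::nat \<Rightarrow> real. \<epsilon> \<in> o(\<lambda>_. 1) \<and>
         (\<forall>\<^sub>F n in sequentially.
            measure_pmf.prob (\<T> n) {T. \<bar>W T - E n\<bar> > t * E n}
            \<le> exp (- (1 / (real b - 1)) * (1 / D) * t * ln (real n) *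
                   (ln (ln (real n)) + ln t + \<alpha> + \<epsilon> n)))))"
proof -
  define \<beta> where "\<beta> = real b - 2"
  \<comment> \<open>The tail is at most \<open>exp (- t / (96 (b - 1)) * log n * log log n)\<close>; with \<open>D = 192\<close> only half
    of this exponent is claimed, and the other half absorbs the constants \<open>log t\<close> and \<open>\<alpha>\<close>.
    This is why the error term 0 suffices.\<close>
  define \<alpha> where "\<alpha> = - ln (4 * 192 * (real b - 1) * exp 1)"
  have beta: "\<beta> \<ge> 0" "1 + \<beta> = real b - 1"
    using assms by (auto simp: \<beta>_def)
  have "\<forall>\<^sub>F n in sequentially. measure_pmf.prob (grow \<beta> (n - 1))
      {T. \<bar>real (wiener_index T) - mean_wiener \<beta> (n - 1)\<bar> > t * mean_wiener \<beta> (n - 1)} \<le>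
    exp (- (1 / (real b - 1)) * (1 / 192) * t * ln (real n) * (ln (ln (real n)) + ln t + \<alpha> + 0))"
    if t: "t > 0" for t :: real
  proof -
    have "\<forall>\<^sub>F n in sequentially. ln (ln (real n)) \<ge> ln t + \<alpha>" "\<forall>\<^sub>F n in sequentially. ln (real n) \<ge> 1"
      by real_asymp+
    with wiener_tail_eventually[OF beta(1) t] show ?thesis
    proof eventually_elim
      case (elim n)
      let ?a = "t / (192 * (1 + \<beta>)) * ln (real n)"
      have "?a * (ln (ln (real n)) + ln t + \<alpha> + 0) \<le> ?a * (2 * ln (ln (real n)))"
        using elim t beta(1) by (intro mult_left_mono) auto
      moreover have "x / (192 * B) * l * (2 * M) = - (- (x / (96 * B)) * l * M)"
          "- (1 / B) * (1 / 192) * x * l * M = - (x / (192 * B) * l * M)" for x B l M :: real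
        by simp_all
      ultimately have "- (t / (96 * (1 + \<beta>))) * ln (real n) * ln (ln (real n)) \<le>
          - (1 / (1 + \<beta>)) * (1 / 192) * t * ln (real n) * (ln (ln (real n)) + ln t + \<alpha> + 0)"
        by (metis neg_le_iff_le minus_minus)
      with elim(1) show ?case
        unfolding beta(2) by (meson exp_le_cancel_iff order_trans)
    qed
  qed
  then have *: "\<exists>\<epsilon>::nat \<Rightarrow> real. \<epsilon> \<in> o(\<lambda>_. 1) \<and> (\<forall>\<^sub>F n in sequentially.
      measure_pmf.prob (grow \<beta> (n - 1))
        {T. \<bar>real (wiener_index T) - mean_wiener \<beta> (n - 1)\<bar> > t * mean_wiener \<beta> (n - 1)} \<le>
      exp (- (1 / (real b - 1)) * (1 / 192) * t * ln (real n) * (ln (ln (real n)) + ln t + \<alpha> + \<epsilon> n)))"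
    if "t > 0" for t :: real
    using that by (intro exI[of _ "\<lambda>_. 0"]) simp
  show ?thesis
    unfolding Let_def linear_recursive_tree_def
    using * by (intro exI[of _ 192]) (simp add: mean_wiener_def \<alpha>_def \<beta>_def)
qed

end
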